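(* Consider Protocol 1 in which Alice's quantum states reach honest Bob through a noisy channel, modelled by a completely positive trace-preserving map $\mathcal E$. Let the channel fidelity be \[ f^0=\tfrac12\sum_{a\in\{0,1\}}\langle\psi_a|\mathcal E(|\psi_a\rangle\langle\psi_a|)|\psi_a\rangle , \] and suppose the threshold satisfies $0<f^*<f^0$. Fix $\theta\in(0,\pi/2]$ independently of $n$. Then the protocol is correct with $\delta_n\le\exp(-n(f^0-f^* )^2/2)$. Moreover, optimizing over all quantum strategies of the dishonest party, as $n\to\infty$: \[ \epsilon_A\le \frac{\sqrt{1-f^*}}{\sqrt2\sin^2\theta}+\frac{1-f^*}{\sin^2\theta}+O\Big(\sqrt{\tfrac{\ln n}{n}}\Big), \qquad \epsilon_B\le\frac{\sin\theta}{2}, \] \[ H_A\ge -n\log_2\Big[\tfrac12+\frac{\sqrt{1-f^*}}{\sqrt2\sin^2\theta}+\frac{1-f^*}{\sin^2\theta}\Big]-O(\sqrt{n\ln n}), \qquad H_B\ge n\,h\Big(\tfrac12(1+\sin\theta)\Big), \] where $h(p)=-p\log_2p-(1-p)\log_2(1-p)$.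
   Context: Protocol 1 (parameters $n\ge1$, $\theta\in(0,\pi/2]$, $f^*\in(0,1]$). Let $|\psi_0\rangle,|\psi_1\rangle$ be pure states with $|\langle\psi_0|\psi_1\rangle|^2=\cos^2\theta$. For $i=1,\dots,n$ in sequence: (a) Alice picks a uniformly random bit $a_i$, prepares $|\psi_{a_i}\rangle$ and sends it to Bob over the quantum channel. (b) Bob picks a uniformly random bit $b_i$ and announces it. (c) Alice announces $a_i$. (d) Bob measures the received system with the projective measurement $\{|\psi_{a_i}\rangle\langle\psi_{a_i}|,\ I-|\psi_{a_i}\rangle\langle\psi_{a_i}|\}$, setting $f_i=1$ for the first outcome and $f_i=0$ otherwise. At the end, Alice outputs $\mathbf x$ with $x_i=a_i\oplus b_i$. If $\sum_i f_i\ge nf^*$, Bob outputs $\mathbf y$ with $y_i=a_i\oplus b_i$; otherwise Bob aborts ($\mathbf y=\perp$). An honest party also aborts if the other visibly fails to follow the protocol (e.g. an expected message never arrives). Classical communication is noiseless. Cheating model. A dishonest party is limited only by quantum mechanics and controls everything outside the honest party's laboratory. In particular, they may replace the quantum channel by a noiseless one. - A dishonest Alice may prepare an arbitrary, possibly entangled, state of many systems, send one system per round, and choose each $a_i$ from adaptive quantum measurements on the systems she keeps. - A dishonest Bob may perform arbitrary measurements on the received systems and choose each $b_i$ adaptively. Correctness. The protocol is correct if, for every $\mathbf c\in\{0,1\}^n$ and honest strategies $H_A,H_B$, \[ (1-\delta_n)2^{-n}\le \mathrm P^{H_AH_B}(\mathbf x=\mathbf y=\mathbf c)\le(1+\delta_n)2^{-n}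 \] with $\delta_n\to0$. Average bias. With $S_A,S_B$ ranging over arbitrary strategies, \[ \tfrac12+\epsilon_A=\max_{S_A,\mathbf c}\frac1n\sum_i \mathrm P^{S_AH_B}(y_i=c_i), \qquad \tfrac12+\epsilon_B=\max_{S_B,\mathbf c}\frac1n\sum_i\mathrm P^{H_AS_B}(x_i=c_i), \] where an abort counts as $y_i\ne c_i$ (respectively $x_i\ne c_i$). Shannon entropy. For the entropy quantities, an honest party who would abort instead outputs a uniformly random $n$-bit string independent of everything else. Then \[ H_A=\min_{S_A}H(\mathrm P^{S_AH_B}(\mathbf y)), \qquad H_B=\min_{S_B}H(\mathrm P^{H_AS_B}(\mathbf x)), \] where $H$ is the Shannon entropy with base-2 logarithms.
   Formalization: A dishonest party is assumed to send every expected message (no refusal causing an abort), since selective refusal by Bob makes the stated bound on H_B fail; quantum systems are finite-dimensional (memories of any finite dimension). *)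

theory Defs
  imports "HOL-Analysis.Analysis"
begin

text \<open>A matrix is a function of row and column index; an r x c matrix is one
that vanishes outside the index range. A tensor index (i, k) in C^m (x) C^d is
encoded as i*d + k.\<close>

type_synonym cmat = "nat \<Rightarrow> nat \<Rightarrow> complex"
type_synonym cvec = "nat \<Rightarrow> complex"

definition mdim :: "nat \<Rightarrow> nat \<Rightarrow> cmat \<Rightarrow> bool" where
  "mdim r c A \<longleftrightarrow> (\<forall>i j. (r \<le> i \<or> c \<le> j) \<longrightarrow> A i j = 0)"

definition mmul :: "nat \<Rightarrow> cmat \<Rightarrow> cmat \<Rightarrow> cmat" where
  "mmul k A B = (\<lambda>i j. \<Sum>l<k. A i l * B l j)"

definition adj :: "cmat \<Rightarrow> cmat" where
  "adj A = (\<lambda>i j. cnj (A j i))"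

definition idm :: "nat \<Rightarrow> cmat" where
  "idm d = (\<lambda>i j. if i = j \<and> i < d then 1 else 0)"

definition kron :: "nat \<Rightarrow> nat \<Rightarrow> cmat \<Rightarrow> cmat \<Rightarrow> cmat" where
  "kron r c A B = (\<lambda>i j. A (i div r) (j div c) * B (i mod r) (j mod c))"

definition mtrace :: "nat \<Rightarrow> cmat \<Rightarrow> complex" where
  "mtrace d A = (\<Sum>i<d. A i i)"

definition ptrace2 :: "nat \<Rightarrow> cmat \<Rightarrow> cmat" where
  "ptrace2 d X = (\<lambda>i j. \<Sum>k<d. X (i * d + k) (j * d + k))"

definition vinner :: "nat \<Rightarrow> cvec \<Rightarrow> cvec \<Rightarrow> complex" where
  "vinner d u v = (\<Sum>i<d. cnj (u i) * v i)"

definition unitvec :: "nat \<Rightarrow> cvec \<Rightarrow> bool" where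
  "unitvec d v \<longleftrightarrow> (\<forall>i. d \<le> i \<longrightarrow> v i = 0) \<and> (\<Sum>i<d. (cmod (v i))\<^sup>2) = 1"

definition proj :: "cvec \<Rightarrow> cmat" where
  "proj v = (\<lambda>i j. v i * cnj (v j))"

definition quadform :: "nat \<Rightarrow> cmat \<Rightarrow> cvec \<Rightarrow> complex" where
  "quadform d A v = (\<Sum>i<d. \<Sum>j<d. cnj (v i) * A i j * v j)"

definition density :: "nat \<Rightarrow> cmat \<Rightarrow> bool" where
  "density d \<rho> \<longleftrightarrow> mdim d d \<rho> \<and>
     (\<forall>v. Im (quadform d \<rho> v) = 0 \<and> 0 \<le> Re (quadform d \<rho> v)) \<and> mtrace d \<rho> = 1"

definition kraus_sum :: "nat \<Rightarrow> cmat list \<Rightarrow> cmat" where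
  "kraus_sum dout Ks = (\<lambda>i j. \<Sum>K\<leftarrow>Ks. mmul dout (adj K) K i j)"

definition cptp :: "nat \<Rightarrow> nat \<Rightarrow> cmat list \<Rightarrow> bool" where
  "cptp din dout Ks \<longleftrightarrow> (\<forall>K\<in>set Ks. mdim dout din K) \<and> kraus_sum dout Ks = idm din"

definition instrument2 :: "nat \<Rightarrow> nat \<Rightarrow> (bool \<Rightarrow> cmat list) \<Rightarrow> bool" where
  "instrument2 din dout Kf \<longleftrightarrow> (\<forall>r. \<forall>K\<in>set (Kf r). mdim dout din K) \<and>
     (\<lambda>i j. kraus_sum dout (Kf False) i j + kraus_sum dout (Kf True) i j) = idm din"

definition kapply :: "nat \<Rightarrow> cmat list \<Rightarrow> cmat \<Rightarrow> cmat" where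
  "kapply din Ks \<rho> = (\<lambda>i j. \<Sum>K\<leftarrow>Ks. mmul din (mmul din K \<rho>) (adj K) i j)"

definition bproj :: "nat \<Rightarrow> (bool \<Rightarrow> cvec) \<Rightarrow> bool \<Rightarrow> bool \<Rightarrow> cmat" where
  "bproj d \<psi> a f = (if f then proj (\<psi> a) else (\<lambda>i j. idm d i j - proj (\<psi> a) i j))"

text \<open>Transcript of a round: (a_i, b_i, f_i); transcripts are chronological lists.\<close>
type_synonym round = "bool \<times> bool \<times> bool"

definition transcripts :: "nat \<Rightarrow> round list set" where
  "transcripts n = {t. length t = n}"

definition xor_out :: "round list \<Rightarrow> bool list" where
  "xor_out t = map (\<lambda>(a, b, f). a \<noteq> b) t"

definition accepts :: "real \<Rightarrow> round list \<Rightarrow> bool" where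
  "accepts fstar t \<longleftrightarrow> real (length t) * fstar \<le> real (length (filter (\<lambda>(a, b, f). f) t))"

definition pass_prob :: "nat \<Rightarrow> (bool \<Rightarrow> cvec) \<Rightarrow> cmat list \<Rightarrow> bool \<Rightarrow> real" where
  "pass_prob d \<psi> EK a = Re (quadform d (kapply d EK (proj (\<psi> a))) (\<psi> a))"

definition chan_fid :: "nat \<Rightarrow> (bool \<Rightarrow> cvec) \<Rightarrow> cmat list \<Rightarrow> real" where
  "chan_fid d \<psi> EK = (pass_prob d \<psi> EK False + pass_prob d \<psi> EK True) / 2"

text \<open>Probability of a transcript when both parties are honest: a_i, b_i uniform,
f_i from Bob's measurement of E(|psi_a><psi_a|).\<close>
definition prob_honest :: "nat \<Rightarrow> (bool \<Rightarrow> cvec) \<Rightarrow> cmat list \<Rightarrow> round list \<Rightarrow> real" where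
  "prob_honest d \<psi> EK t = (\<Prod>(a, b, f)\<leftarrow>t.
      (1/4) * (if f then pass_prob d \<psi> EK a else 1 - pass_prob d \<psi> EK a))"

text \<open>P(x = y = c): honest Alice outputs a XOR b, honest Bob the same unless he aborts.\<close>
definition honest_xy :: "nat \<Rightarrow> (bool \<Rightarrow> cvec) \<Rightarrow> cmat list \<Rightarrow> real \<Rightarrow> nat \<Rightarrow> bool list \<Rightarrow> real" where
  "honest_xy d \<psi> EK fstar n c = (\<Sum>t\<in>transcripts n.
      prob_honest d \<psi> EK t * (if accepts fstar t \<and> xor_out t = c then 1 else 0))"

text \<open>General strategy: quantum memory C^m with initial state; in each round a
CPTP map from the memory to memory (x) sent system C^d (adaptive on the
classical history of (a,b) pairs, newest first), and after Bob's b_i a two-outcome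
instrument on the memory producing a_i. The channel is under Alice's control,
so it is noiseless without loss of generality.\<close>

record astrat =
  amem :: nat
  ainit :: cmat
  aprep :: "(bool \<times> bool) list \<Rightarrow> cmat list"
  ameas :: "(bool \<times> bool) list \<Rightarrow> bool \<Rightarrow> bool \<Rightarrow> cmat list"

definition valid_astrat :: "nat \<Rightarrow> astrat \<Rightarrow> bool" where
  "valid_astrat d S \<longleftrightarrow> 0 < amem S \<and> density (amem S) (ainit S) \<and>
     (\<forall>h. cptp (amem S) (amem S * d) (aprep S h)) \<and>
     (\<forall>h b. instrument2 (amem S) (amem S) (ameas S h b))"

text \<open>Unnormalised memory state conditioned on a history (newest round first).\<close>
fun stA :: "nat \<Rightarrow> (bool \<Rightarrow> cvec) \<Rightarrow> astrat \<Rightarrow> round list \<Rightarrow> cmat" where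
  "stA d \<psi> S [] = ainit S"
| "stA d \<psi> S ((a, b, f) # h) =
     (let m = amem S; hc = map (\<lambda>(a, b, f). (a, b)) h;
          X = kapply m (aprep S hc) (stA d \<psi> S h);
          Z = kapply (m * d) (map (\<lambda>K. kron d d K (idm d)) (ameas S hc b a)) X;
          P = kron d d (idm m) (bproj d \<psi> a f);
          W = mmul (m * d) (mmul (m * d) P Z) P
      in (\<lambda>i j. ptrace2 d W i j / 2))"

definition probA :: "nat \<Rightarrow> (bool \<Rightarrow> cvec) \<Rightarrow> astrat \<Rightarrow> round list \<Rightarrow> real" where
  "probA d \<psi> S t = Re (mtrace (amem S) (stA d \<psi> S (rev t)))"

text \<open>(1/n) sum_i P(y_i = c_i), an abort counting as y_i ~= c_i.\<close>
definition avgA :: "nat \<Rightarrow> (bool \<Rightarrow> cvec) \<Rightarrow> real \<Rightarrow> nat \<Rightarrow> astrat \<Rightarrow> bool list \<Rightarrow> real" where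
  "avgA d \<psi> fstar n S c = (1 / real n) * (\<Sum>i<n. \<Sum>t\<in>transcripts n.
      probA d \<psi> S t * (if accepts fstar t \<and> xor_out t ! i = c ! i then 1 else 0))"

text \<open>Distribution of Bob's output, an abort replaced by a uniform n-bit string.\<close>
definition ydistA :: "nat \<Rightarrow> (bool \<Rightarrow> cvec) \<Rightarrow> real \<Rightarrow> nat \<Rightarrow> astrat \<Rightarrow> bool list \<Rightarrow> real" where
  "ydistA d \<psi> fstar n S c = (\<Sum>t\<in>transcripts n.
      probA d \<psi> S t * (if accepts fstar t then (if xor_out t = c then 1 else 0) else 1 / 2 ^ n))"

text \<open>General strategy: quantum memory C^m with initial state; in round i, a
two-outcome instrument from memory (x) received system to memory producing b_i,
adaptive on the history of (a,b) pairs (newest first).\<close>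

record bstrat =
  bmem :: nat
  binit :: cmat
  binst :: "(bool \<times> bool) list \<Rightarrow> bool \<Rightarrow> cmat list"

definition valid_bstrat :: "nat \<Rightarrow> bstrat \<Rightarrow> bool" where
  "valid_bstrat d S \<longleftrightarrow> 0 < bmem S \<and> density (bmem S) (binit S) \<and>
     (\<forall>h. instrument2 (bmem S * d) (bmem S) (binst S h))"

fun stB :: "nat \<Rightarrow> (bool \<Rightarrow> cvec) \<Rightarrow> bstrat \<Rightarrow> (bool \<times> bool) list \<Rightarrow> cmat" where
  "stB d \<psi> S [] = binit S"
| "stB d \<psi> S ((a, b) # h) =
     (\<lambda>i j. kapply (bmem S * d) (binst S h b) (kron d d (stB d \<psi> S h) (proj (\<psi> a))) i j / 2)"

definition probB :: "nat \<Rightarrow> (bool \<Rightarrow> cvec) \<Rightarrow> bstrat \<Rightarrow> (bool \<times> bool) list \<Rightarrow> real" where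
  "probB d \<psi> S t = Re (mtrace (bmem S) (stB d \<psi> S (rev t)))"

definition xor_outB :: "(bool \<times> bool) list \<Rightarrow> bool list" where
  "xor_outB t = map (\<lambda>(a, b). a \<noteq> b) t"

definition transcriptsB :: "nat \<Rightarrow> (bool \<times> bool) list set" where
  "transcriptsB n = {t. length t = n}"

definition avgB :: "nat \<Rightarrow> (bool \<Rightarrow> cvec) \<Rightarrow> nat \<Rightarrow> bstrat \<Rightarrow> bool list \<Rightarrow> real" where
  "avgB d \<psi> n S c = (1 / real n) * (\<Sum>i<n. \<Sum>t\<in>transcriptsB n.
      probB d \<psi> S t * (if xor_outB t ! i = c ! i then 1 else 0))"

definition xdistB :: "nat \<Rightarrow> (bool \<Rightarrow> cvec) \<Rightarrow> nat \<Rightarrow> bstrat \<Rightarrow> bool list \<Rightarrow> real" where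
  "xdistB d \<psi> n S c = (\<Sum>t\<in>transcriptsB n.
      probB d \<psi> S t * (if xor_outB t = c then 1 else 0))"

definition ent_term :: "real \<Rightarrow> real" where
  "ent_term p = (if p = 0 then 0 else - p * log 2 p)"

definition shannon :: "('a \<Rightarrow> real) \<Rightarrow> 'a set \<Rightarrow> real" where
  "shannon P X = (\<Sum>x\<in>X. ent_term (P x))"

definition bin_ent :: "real \<Rightarrow> real" where
  "bin_ent p = ent_term p + ent_term (1 - p)"

definition bitstrings :: "nat \<Rightarrow> bool list set" where
  "bitstrings n = {c. length c = n}"

end

theory Submission
  imports Defs
begin

text \<open>
  Dishonest Alice: Bob's share of the joint state cannot depend on his bit \<open>b\<close>. If the rounds pass the test,
  that share is close to a mixture of \<open>\<psi>\<^sub>0\<close> and \<open>\<psi>\<^sub>1\<close> with weights given by the distribution of \<open>a\<close>; comparing the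
  two values of \<open>b\<close> bounds the cheating probability of a single round, conditioned on the past, by a
  concave function of the failure probability. Replacing this function by its tangent at \<open>1 - f\<^sup>*\<close> makes the bound linear, so
  exponential supermartingales control the whole string. For the entropy, the accepted transcripts whose conditional
  failure probabilities sum to about \<open>n (1 - f\<^sup>*)\<close> give every string probability at
  most \<open>G\<^sup>n exp (O (sqrt (n ln n)))\<close>, and the other accepted transcripts have total weight at most \<open>1/n\<close>.

  Dishonest Bob: in each round he has to discriminate two pure states prepared independently of the past, so
  Helstrom's bound applies conditionally on the past, and the chain rule gives the entropy.
\<close>

text \<open>The comparison of the two values of \<open>b\<close> contains one cross term, which the
  arithmetic-geometric mean inequality with a free weight \<open>t\<close> controls. Every
  \<open>t\<close> > 0 thus gives a bound that is already affine in the failure probability x,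
  namely 1/2 + t/(2 s^2) + (1/(4 t s^2) + 1/s^2) x with s = sin \<theta>. The concave function is
  the infimum of these lines and is never formed. Only intercept and slope reach the probabilistic
  part, as 1/2 + \<beta> and \<alpha> of \<open>string_process\<close>.

  The obstacle in the entropy bound is that this inequality charges an output bit with all failures
  of the round, including those under the opposite bit. Along one fixed string the observed failures
  may be few although the failure probabilities are large, so acceptance does not directly bound the
  probability of that string. Hence strings are weighted by the conditional failure probabilities,
  which are fixed before the current output, and acceptance is linked to them by a deviation bound
  over all transcripts at once.\<close>

subsection \<open>Positive matrices and traces\<close>

text \<open>Only real parts are constrained: hermiticity is never needed.\<close>
definition psd :: "nat \<Rightarrow> cmat \<Rightarrow> bool" where
  "psd d A \<longleftrightarrow> (\<forall>v. 0 \<le> Re (quadform d A v))"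

lemma if_zero_distribs:
  fixes x y :: complex
  shows "(if b then x else 0) * y = (if b then x * y else 0)"
    and "y * (if b then x else 0) = (if b then y * x else 0)"
    and "cnj (if b then x else 0) = (if b then cnj x else 0)"
    and "(\<Sum>l\<in>L. if b then f l else 0) = (if b then \<Sum>l\<in>L. f l else (0::complex))"
  by auto

lemma sum_prod_index: "(\<Sum>I<m*d. f I) = (\<Sum>i<m. \<Sum>k<d. f (i * d + k))"
  for f :: "nat \<Rightarrow> 'a::comm_monoid_add"
proof -
  have "(\<Sum>I<m*d. f I) = (\<Sum>i<m. sum f {i*d..<i*d+d})"
    by (rule sum.nat_group[symmetric])
  also have "\<dots> = (\<Sum>i<m. \<Sum>k<d. f (i * d + k))"
  proof (rule sum.cong[OF refl])
    fix i
    show "sum f {i*d..<i*d+d} = (\<Sum>k<d. f (i * d + k))"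
      using sum.shift_bounds_nat_ivl[of f 0 "i*d" d]
      by (simp add: add.commute lessThan_atLeast0)
  qed
  finally show ?thesis .
qed

lemma kapply_Nil: "kapply m [] \<rho> = (\<lambda>i j. 0)"
  by (simp add: kapply_def)

lemma kapply_Cons: "kapply m (K # Ks) \<rho> =
    (\<lambda>i j. (\<Sum>l<m. \<Sum>l'<m. K i l * \<rho> l l' * cnj (K j l')) + kapply m Ks \<rho> i j)"
proof -
  have "mmul m (mmul m K \<rho>) (adj K) i j = (\<Sum>l<m. \<Sum>l'<m. K i l * \<rho> l l' * cnj (K j l'))" for i j
    unfolding mmul_def adj_def sum_distrib_right by (rule sum.swap)
  then show ?thesis by (simp add: kapply_def)
qed

lemma kraus_sum_Nil: "kraus_sum m [] i j = 0"
  by (simp add: kraus_sum_def)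

lemma kraus_sum_Cons: "kraus_sum m (K # Ks) i j = (\<Sum>l<m. cnj (K l i) * K l j) + kraus_sum m Ks i j"
  by (simp add: kraus_sum_def mmul_def adj_def)

lemma quadform_add: "quadform d (\<lambda>i j. A i j + B i j) v = quadform d A v + quadform d B v"
  by (simp add: quadform_def sum.distrib algebra_simps)

lemma quadform_divide: "quadform d (\<lambda>i j. A i j / z) v = quadform d A v / z"
  by (simp add: quadform_def sum_divide_distrib)

lemma quadform_zero: "quadform d (\<lambda>i j. 0) v = 0"
  by (simp add: quadform_def)

lemma quadform_conjugate:
  "quadform n (\<lambda>i j. \<Sum>l<m. \<Sum>l'<m. K i l * \<rho> l l' * cnj (K j l')) v
   = quadform m \<rho> (\<lambda>j. \<Sum>i<n. cnj (K i j) * v i)"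
proof -
  have "quadform m \<rho> (\<lambda>j. \<Sum>i<n. cnj (K i j) * v i)
      = (\<Sum>l<m. \<Sum>l'<m. \<Sum>j<n. \<Sum>i<n. cnj (v i) * (K i l * \<rho> l l' * cnj (K j l')) * v j)"
    unfolding quadform_def cnj_sum sum_distrib_left sum_distrib_right
    by (intro sum.cong refl) (simp add: mult_ac)
  also have "\<dots> = (\<Sum>l<m. \<Sum>l'<m. \<Sum>i<n. \<Sum>j<n. cnj (v i) * (K i l * \<rho> l l' * cnj (K j l')) * v j)"
    by (rule sum.cong[OF refl], rule sum.cong[OF refl], rule sum.swap)
  also have "\<dots> = (\<Sum>l<m. \<Sum>i<n. \<Sum>j<n. \<Sum>l'<m. cnj (v i) * (K i l * \<rho> l l' * cnj (K j l')) * v j)"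
    by (rule sum.cong[OF refl], subst sum.swap, rule sum.cong[OF refl], rule sum.swap)
  also have "\<dots> = (\<Sum>i<n. \<Sum>j<n. \<Sum>l<m. \<Sum>l'<m. cnj (v i) * (K i l * \<rho> l l' * cnj (K j l')) * v j)"
    by (subst sum.swap, rule sum.cong[OF refl], rule sum.swap)
  also have "\<dots> = quadform n (\<lambda>i j. \<Sum>l<m. \<Sum>l'<m. K i l * \<rho> l l' * cnj (K j l')) v"
    unfolding quadform_def sum_distrib_left sum_distrib_right ..
  finally show ?thesis ..
qed

lemma psd_kapply:
  assumes "psd m \<rho>"
  shows "psd n (kapply m Ks \<rho>)"
proof (induction Ks)
  case Nil
  then show ?case by (simp add: psd_def kapply_Nil quadform_zero)
next
  case (Cons K Ks)
  then show ?case using assms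
    by (simp add: psd_def kapply_Cons quadform_add quadform_conjugate)
qed

text \<open>Cyclicity of the trace: only the sum of the K^dagger K survives, so the completeness
  relations in \<open>cptp\<close> and \<open>instrument2\<close> can be substituted as they
  stand.\<close>

lemma mtrace_kapply:
  "mtrace n (kapply m Ks \<rho>) = (\<Sum>l<m. \<Sum>l'<m. kraus_sum n Ks l' l * \<rho> l l')"
proof (induction Ks)
  case Nil
  then show ?case by (simp add: mtrace_def kapply_Nil kraus_sum_Nil)
next
  case (Cons K Ks)
  have "(\<Sum>i<n. \<Sum>l<m. \<Sum>l'<m. K i l * \<rho> l l' * cnj (K i l'))
      = (\<Sum>l<m. \<Sum>l'<m. \<Sum>i<n. K i l * \<rho> l l' * cnj (K i l'))"
    by (subst sum.swap, rule sum.cong[OF refl], rule sum.swap)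
  also have "\<dots> = (\<Sum>l<m. \<Sum>l'<m. (\<Sum>i<n. cnj (K i l') * K i l) * \<rho> l l')"
    unfolding sum_distrib_right by (intro sum.cong refl) (simp add: mult_ac)
  finally show ?case using Cons
    by (simp add: mtrace_def kapply_Cons kraus_sum_Cons sum.distrib distrib_right)
qed

lemma sum_idm: "(\<Sum>l'<m. idm m l' l * f l') = (if l < m then f l else 0)"
proof -
  have "(\<Sum>l'<m. idm m l' l * f l') = (\<Sum>l'<m. if l' = l then f l' else 0)"
    by (intro sum.cong) (auto simp: idm_def)
  then show ?thesis by simp
qed

lemma sum_idm': "(\<Sum>l'<m. idm m l l' * f l') = (if l < m then f l else 0)"
proof -
  have "idm m l l' = idm m l' l" for l' by (auto simp: idm_def)
  then show ?thesis using sum_idm[of m l f] by simp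
qed

lemma sum_idm_quadratic: "(\<Sum>l<m. \<Sum>l'<m. idm m l' l * A l l') = mtrace m A"
  by (simp add: sum_idm mtrace_def)

lemma mtrace_kapply_cptp:
  assumes "cptp m n Ks"
  shows "mtrace n (kapply m Ks \<rho>) = mtrace m \<rho>"
proof -
  have "kraus_sum n Ks = idm m" using assms by (simp add: cptp_def)
  then show ?thesis unfolding mtrace_kapply by (simp add: sum_idm_quadratic)
qed

lemma instrument2_sum:
  assumes "instrument2 m n Kf"
  shows "(\<Sum>a\<in>UNIV. kraus_sum n (Kf a) i j) = idm m i j"
proof -
  have "(\<lambda>i j. kraus_sum n (Kf False) i j + kraus_sum n (Kf True) i j) = idm m"
    using assms by (simp add: instrument2_def)
  from fun_cong[OF fun_cong[OF this, of i], of j] show ?thesis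
    by (simp add: UNIV_bool add.commute)
qed

lemma psd_mtrace_nonneg:
  assumes "psd d A"
  shows "0 \<le> Re (mtrace d A)"
proof -
  have q: "quadform d A (\<lambda>j. if j = i then 1 else 0) = A i i" if "i < d" for i
  proof -
    show ?thesis unfolding quadform_def using that by (simp add: if_zero_distribs)
  qed
  have "Re (mtrace d A) = (\<Sum>i<d. Re (quadform d A (\<lambda>j. if j = i then 1 else 0)))"
    by (simp add: mtrace_def q)
  also have "\<dots> \<ge> 0" using assms by (intro sum_nonneg) (simp add: psd_def)
  finally show ?thesis .
qed

lemma psd_proj: "psd d (proj v)"
proof -
  have "quadform d (proj v) w = (\<Sum>i<d. cnj (w i) * v i) * cnj (\<Sum>i<d. cnj (w i) * v i)" for w
    unfolding quadform_def proj_def cnj_sum sum_product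
    by (intro sum.cong refl) (simp add: mult_ac)
  then show ?thesis unfolding psd_def complex_norm_square[symmetric] by simp
qed

section \<open>Partial traces and local operations on memory and sent system\<close>

definition ptr1 :: "nat \<Rightarrow> nat \<Rightarrow> cmat \<Rightarrow> cmat" where
  "ptr1 m d X = (\<lambda>k l. \<Sum>i<m. X (i * d + k) (i * d + l))"

lemma mtrace_ptr1: "mtrace d (ptr1 m d X) = mtrace (m * d) X"
  unfolding mtrace_def ptr1_def sum_prod_index by (rule sum.swap)

text \<open>The form of the partial trace at \<open>v\<close> is the sum over i of the forms of
  \<open>X\<close> at the product vectors e_i (x) v; \<open>?w i\<close> is that vector in the index
  encoding.\<close>

lemma psd_ptr1:
  assumes "psd (m * d) X"
  shows "psd d (ptr1 m d X)"
  unfolding psd_def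
proof
  fix v :: cvec
  let ?w = "\<lambda>i I. if I div d = i then v (I mod d) else 0"
  have *: "quadform (m * d) X (?w i) = (\<Sum>k<d. \<Sum>l<d. cnj (v k) * X (i*d+k) (i*d+l) * v l)"
    if "i < m" for i
  proof -
    have "quadform (m * d) X (?w i) = (\<Sum>i'<m. \<Sum>k<d. \<Sum>j'<m. \<Sum>l<d.
        if i' = i then if j' = i then cnj (v k) * X (i'*d+k) (j'*d+l) * v l else 0 else 0)"
      unfolding quadform_def sum_prod_index by (intro sum.cong refl) auto
    then show ?thesis using that by (simp add: if_zero_distribs)
  qed
  have "quadform d (ptr1 m d X) v = (\<Sum>k<d. \<Sum>l<d. \<Sum>i<m. cnj (v k) * X (i*d+k) (i*d+l) * v l)"
    unfolding quadform_def ptr1_def sum_distrib_left sum_distrib_right ..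
  also have "\<dots> = (\<Sum>k<d. \<Sum>i<m. \<Sum>l<d. cnj (v k) * X (i*d+k) (i*d+l) * v l)"
    by (rule sum.cong[OF refl], rule sum.swap)
  also have "\<dots> = (\<Sum>i<m. \<Sum>k<d. \<Sum>l<d. cnj (v k) * X (i*d+k) (i*d+l) * v l)"
    by (rule sum.swap)
  also have "\<dots> = (\<Sum>i<m. quadform (m * d) X (?w i))"
    by (intro sum.cong refl) (simp add: *)
  finally show "0 \<le> Re (quadform d (ptr1 m d X) v)"
    using assms by (simp add: psd_def sum_nonneg)
qed

lemma psd_ptrace2:
  assumes "psd (m * d) X"
  shows "psd m (ptrace2 d X)"
  unfolding psd_def
proof
  fix v :: cvec
  let ?w = "\<lambda>k I. if I mod d = k then v (I div d) else 0"
  have *: "quadform (m * d) X (?w k) = (\<Sum>i<m. \<Sum>j<m. cnj (v i) * X (i*d+k) (j*d+k) * v j)"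
    if "k < d" for k
  proof -
    have "quadform (m * d) X (?w k) = (\<Sum>i<m. \<Sum>k'<d. \<Sum>j<m. \<Sum>l<d.
        if k' = k then if l = k then cnj (v i) * X (i*d+k') (j*d+l) * v j else 0 else 0)"
      unfolding quadform_def sum_prod_index by (intro sum.cong refl) auto
    then show ?thesis using that by (simp add: if_zero_distribs)
  qed
  have "quadform m (ptrace2 d X) v = (\<Sum>i<m. \<Sum>j<m. \<Sum>k<d. cnj (v i) * X (i*d+k) (j*d+k) * v j)"
    unfolding quadform_def ptrace2_def sum_distrib_left sum_distrib_right ..
  also have "\<dots> = (\<Sum>i<m. \<Sum>k<d. \<Sum>j<m. cnj (v i) * X (i*d+k) (j*d+k) * v j)"
    by (rule sum.cong[OF refl], rule sum.swap)
  also have "\<dots> = (\<Sum>k<d. \<Sum>i<m. \<Sum>j<m. cnj (v i) * X (i*d+k) (j*d+k) * v j)"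
    by (rule sum.swap)
  also have "\<dots> = (\<Sum>k<d. quadform (m * d) X (?w k))"
    by (intro sum.cong refl) (simp add: *)
  finally show "0 \<le> Re (quadform m (ptrace2 d X) v)"
    using assms by (simp add: psd_def sum_nonneg)
qed

lemma sum_kron_idm_right:
  assumes "k < d"
  shows "(\<Sum>I<m*d. kron d d K (idm d) (i * d + k) I * F I) = (\<Sum>i'<m. K i i' * F (i' * d + k))"
proof -
  have "(\<Sum>I<m*d. kron d d K (idm d) (i * d + k) I * F I)
     = (\<Sum>i'<m. \<Sum>k'<d. idm d k k' * (K i i' * F (i' * d + k')))"
    unfolding sum_prod_index using assms by (intro sum.cong refl) (simp add: kron_def mult_ac)
  then show ?thesis using assms by (simp add: sum_idm')
qed

text \<open>For the sent system, an operation on the memory is visible only through its Kraus sum.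
  This is the source of no-signalling: once the Kraus sums over Alice's answers add up to the
  identity, her operation disappears.\<close>

lemma ptr1_kapply_kron:
  assumes "k < d" "l < d"
  shows "ptr1 n d (kapply (m * d) (map (\<lambda>K. kron d d K (idm d)) Ks) X) k l
       = (\<Sum>i<m. \<Sum>j<m. kraus_sum n Ks j i * X (i * d + k) (j * d + l))"
proof (induction Ks)
  case Nil
  then show ?case by (simp add: ptr1_def kapply_Nil kraus_sum_Nil)
next
  case (Cons K Ks)
  let ?K = "kron d d K (idm d)"
  have 1: "(\<Sum>I<m*d. \<Sum>J<m*d. ?K (i*d+k) I * X I J * cnj (?K (i*d+l) J))
      = (\<Sum>i'<m. \<Sum>j'<m. cnj (K i j') * K i i' * X (i'*d+k) (j'*d+l))" for i
  proof -
    have "(\<Sum>I<m*d. \<Sum>J<m*d. ?K (i*d+k) I * X I J * cnj (?K (i*d+l) J))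
       = (\<Sum>I<m*d. ?K (i*d+k) I * cnj (\<Sum>J<m*d. ?K (i*d+l) J * cnj (X I J)))"
      by (simp add: sum_distrib_left mult_ac)
    also have "\<dots> = (\<Sum>i'<m. K i i' * cnj (\<Sum>j'<m. K i j' * cnj (X (i'*d+k) (j'*d+l))))"
      using assms by (simp only: sum_kron_idm_right)
    also have "\<dots> = (\<Sum>i'<m. \<Sum>j'<m. cnj (K i j') * K i i' * X (i'*d+k) (j'*d+l))"
      by (simp add: sum_distrib_left mult_ac)
    finally show ?thesis .
  qed
  have 2: "(\<Sum>i<n. \<Sum>i'<m. \<Sum>j'<m. cnj (K i j') * K i i' * X (i'*d+k) (j'*d+l))
     = (\<Sum>i'<m. \<Sum>j'<m. (\<Sum>i<n. cnj (K i j') * K i i') * X (i'*d+k) (j'*d+l))"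
    unfolding sum_distrib_right
    by (subst sum.swap, rule sum.cong[OF refl], rule sum.swap)
  show ?case using Cons
    by (simp add: ptr1_def kapply_Cons kraus_sum_Cons sum.distrib distrib_right 1 2)
qed

text \<open>Cyclicity and idempotence on the sent system merge the two copies of the projection into
  one. The probabilities of Bob's test therefore depend on the joint state only through its
  reduction \<open>ptr1\<close>.\<close>

lemma mtrace_projected:
  assumes idem: "\<And>k l. k < d \<Longrightarrow> l < d \<Longrightarrow> (\<Sum>j<d. B k j * B j l) = B k l"
  shows "mtrace m (ptrace2 d (mmul (m * d) (mmul (m * d) (kron d d (idm m) B) Z) (kron d d (idm m) B)))
      = (\<Sum>k<d. \<Sum>l<d. B l k * ptr1 m d Z k l)"
proof -
  let ?P = "kron d d (idm m) B"
  have left: "(\<Sum>I<m*d. ?P (i*d+k) I * F I) = (\<Sum>k'<d. B k k' * F (i*d+k'))"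
    if "i < m" "k < d" for i k and F :: "nat \<Rightarrow> complex"
  proof -
    have "(\<Sum>I<m*d. ?P (i*d+k) I * F I) = (\<Sum>i'<m. idm m i i' * (\<Sum>k'<d. B k k' * F (i'*d+k')))"
      unfolding sum_prod_index sum_distrib_left using that
      by (intro sum.cong refl) (simp add: kron_def mult_ac)
    then show ?thesis using that by (simp add: sum_idm')
  qed
  have right: "(\<Sum>I<m*d. F I * ?P I (i*d+k)) = (\<Sum>k'<d. B k' k * F (i*d+k'))"
    if "i < m" "k < d" for i k and F :: "nat \<Rightarrow> complex"
  proof -
    have "(\<Sum>I<m*d. F I * ?P I (i*d+k)) = (\<Sum>i'<m. idm m i' i * (\<Sum>k'<d. B k' k * F (i'*d+k')))"
      unfolding sum_prod_index sum_distrib_left using that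
      by (intro sum.cong refl) (simp add: kron_def mult_ac)
    then show ?thesis using that by (simp add: sum_idm)
  qed
  have "mtrace m (ptrace2 d (mmul (m * d) (mmul (m * d) ?P Z) ?P))
     = (\<Sum>i<m. \<Sum>j<d. \<Sum>l<d. \<Sum>k<d. B l j * B j k * Z (i*d+k) (i*d+l))"
    unfolding mtrace_def ptrace2_def
  proof (intro sum.cong refl, goal_cases)
    case (1 i j)
    have "mmul (m*d) ?P Z (i*d+j) l = (\<Sum>k<d. B j k * Z (i*d+k) l)" for l
      using 1 unfolding mmul_def by (simp add: left)
    then show ?case using 1 unfolding mmul_def[of "m*d" "mmul (m*d) ?P Z"]
      by (simp only: right lessThan_iff sum_distrib_left mult.assoc)
  qed
  also have "\<dots> = (\<Sum>i<m. \<Sum>l<d. \<Sum>j<d. \<Sum>k<d. B l j * B j k * Z (i*d+k) (i*d+l))"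
    by (rule sum.cong[OF refl], rule sum.swap)
  also have "\<dots> = (\<Sum>i<m. \<Sum>l<d. \<Sum>k<d. \<Sum>j<d. B l j * B j k * Z (i*d+k) (i*d+l))"
    by (rule sum.cong[OF refl], rule sum.cong[OF refl], rule sum.swap)
  also have "\<dots> = (\<Sum>i<m. \<Sum>l<d. \<Sum>k<d. B l k * Z (i*d+k) (i*d+l))"
    by (intro sum.cong refl) (simp add: sum_distrib_right[symmetric] idem)
  also have "\<dots> = (\<Sum>l<d. \<Sum>k<d. \<Sum>i<m. B l k * Z (i*d+k) (i*d+l))"
    by (subst sum.swap, rule sum.cong[OF refl], rule sum.swap)
  also have "\<dots> = (\<Sum>k<d. \<Sum>l<d. B l k * ptr1 m d Z k l)"
    unfolding ptr1_def sum_distrib_left by (rule sum.swap)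
  finally show ?thesis .
qed

section \<open>Quadratic forms on the plane spanned by two unit vectors\<close>

definition sform :: "nat \<Rightarrow> cmat \<Rightarrow> cvec \<Rightarrow> cvec \<Rightarrow> complex" where
  "sform d A u v = (\<Sum>i<d. \<Sum>j<d. cnj (u i) * A i j * v j)"

lemma quadform_combination:
  "quadform d A (\<lambda>i. of_real a * u i + of_real b * w i) =
     of_real (a\<^sup>2) * quadform d A u + of_real (b\<^sup>2) * quadform d A w
     + of_real (a * b) * (sform d A u w + sform d A w u)"
proof -
  have "cnj (of_real a * u i + of_real b * w i) * A i j * (of_real a * u j + of_real b * w j) =
     of_real (a\<^sup>2) * (cnj (u i) * A i j * u j) + of_real (b\<^sup>2) * (cnj (w i) * A i j * w j)
     + of_real (a * b) * (cnj (u i) * A i j * w j + cnj (w i) * A i j * u j)" for i j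
    by (simp add: algebra_simps power2_eq_square)
  then show ?thesis
    by (simp only: quadform_def sform_def sum.distrib sum_distrib_left[symmetric])
qed

lemma quadform_scale: "quadform d A (\<lambda>i. z * v i) = of_real ((cmod z)\<^sup>2) * quadform d A v"
proof -
  have "cnj (z * v i) * A i j * (z * v j) = (z * cnj z) * (cnj (v i) * A i j * v j)" for i j
    by (simp add: mult_ac)
  then show ?thesis
    by (simp only: quadform_def sum_distrib_left[symmetric] complex_norm_square)
qed

lemma vinner_commute: "vinner d u v = cnj (vinner d v u)"
  by (simp add: vinner_def mult.commute)

lemma vinner_unit:
  assumes "unitvec d u"
  shows "vinner d u u = 1"
proof -
  have "vinner d u u = of_real (\<Sum>i<d. (cmod (u i))\<^sup>2)"
    unfolding vinner_def of_real_sum by (intro sum.cong refl) (metis complex_norm_square mult.commute)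
  then show ?thesis using assms by (simp add: unitvec_def del: of_real_sum of_real_power)
qed

text \<open>\<open>e i\<close> is the i-th basis vector projected onto the orthogonal complement of
  \<open>u\<close> and \<open>w\<close>. Summing the forms of \<open>A\<close> over these vectors
  gives the trace of \<open>A\<close> compressed to that complement. The alternative of a vanishing
  \<open>w\<close> covers the case of a single vector.\<close>

lemma bessel_quadform:
  assumes psd: "psd d A" and u: "vinner d u u = 1" and w: "vinner d w w = 1 \<or> w = (\<lambda>_. 0)" and uw: "vinner d u w = 0"
  shows "Re (quadform d A u) + Re (quadform d A w) \<le> Re (mtrace d A)"
proof -
  define e where "e i k = idm d i k - cnj (u i) * u k - cnj (w i) * w k" for i k
  have wu: "vinner d w u = 0" using uw vinner_commute[of d w u] by simp
  have gram: "(\<Sum>i<d. cnj (e i k) * e i l) = idm d k l - cnj (u k) * u l - cnj (w k) * w l"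
    if "k < d" "l < d" for k l
  proof -
    have "cnj (e i k) * e i l = idm d i k * (idm d i l - cnj (u i) * u l - cnj (w i) * w l)
        - idm d i l * (u i * cnj (u k) + w i * cnj (w k))
        + (cnj (u i) * u i) * (cnj (u k) * u l) + (cnj (w i) * w i) * (cnj (w k) * w l)
        + (cnj (w i) * u i) * (cnj (u k) * w l) + (cnj (u i) * w i) * (cnj (w k) * u l)" for i
      by (simp add: e_def idm_def algebra_simps)
    then have "(\<Sum>i<d. cnj (e i k) * e i l) = (\<Sum>i<d. idm d i k * (idm d i l - cnj (u i) * u l - cnj (w i) * w l))
        - (\<Sum>i<d. idm d i l * (u i * cnj (u k) + w i * cnj (w k)))
        + vinner d u u * (cnj (u k) * u l) + vinner d w w * (cnj (w k) * w l)
        + vinner d w u * (cnj (u k) * w l) + vinner d u w * (cnj (w k) * u l)"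
      by (simp only: sum.distrib sum_subtractf sum_distrib_right[symmetric] vinner_def)
    also have "\<dots> = idm d k l - cnj (u k) * u l - cnj (w k) * w l"
      unfolding u uw wu sum_idm using w that by (auto simp: algebra_simps)
    finally show ?thesis .
  qed
  have "(\<Sum>i<d. quadform d A (e i)) = (\<Sum>k<d. \<Sum>i<d. \<Sum>l<d. cnj (e i k) * A k l * e i l)"
    unfolding quadform_def by (rule sum.swap)
  also have "\<dots> = (\<Sum>k<d. \<Sum>l<d. \<Sum>i<d. cnj (e i k) * A k l * e i l)"
    by (rule sum.cong[OF refl], rule sum.swap)
  also have "\<dots> = (\<Sum>k<d. \<Sum>l<d. A k l * (\<Sum>i<d. cnj (e i k) * e i l))"
    by (simp add: sum_distrib_left mult_ac)
  also have "\<dots> = (\<Sum>k<d. \<Sum>l<d. idm d k l * A k l - cnj (u k) * A k l * u l - cnj (w k) * A k l * w l)"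
    by (intro sum.cong refl) (simp only: gram lessThan_iff, simp add: algebra_simps)
  also have "\<dots> = mtrace d A - quadform d A u - quadform d A w"
    by (simp add: sum_subtractf sum_idm' mtrace_def quadform_def)
  finally have "Re (mtrace d A - quadform d A u - quadform d A w) = (\<Sum>i<d. Re (quadform d A (e i)))"
    by (metis Re_sum)
  also have "\<dots> \<ge> 0" using psd by (intro sum_nonneg) (simp add: psd_def)
  finally show ?thesis by simp
qed

lemma quadform_le_mtrace:
  assumes "psd d A" "vinner d u u = 1"
  shows "Re (quadform d A u) \<le> Re (mtrace d A)"
  using bessel_quadform[OF assms, of "\<lambda>_. 0"] by (simp add: vinner_def quadform_def)

text \<open>Gram-Schmidt, with the phase of the overlap moved into \<open>g\<close>, so that the
  coordinates in the plane are the real numbers \<open>c\<close> and \<open>s\<close>, later cosine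
  and sine of \<theta>.\<close>

lemma unit_pair_decomposition:
  assumes u: "vinner d u u = 1" and v: "vinner d v v = 1"
    and c: "cmod (vinner d u v) = c" and s: "0 < s" "c\<^sup>2 + s\<^sup>2 = 1"
  obtains w g where "vinner d w w = 1" "vinner d u w = 0" "cmod g = 1"
    "v = (\<lambda>i. g * (of_real c * u i + of_real s * w i))"
proof -
  define z where "z = vinner d u v"
  \<comment> \<open>For orthogonal vectors the phase is arbitrary; 1 keeps the modulus
    right.\<close>
  define g where "g = (if z = 0 then 1 else z / of_real (cmod z))"
  have g: "cmod g = 1" by (simp add: g_def norm_divide)
  have zg: "z = g * of_real c" using c by (auto simp: g_def z_def)
  have gg: "g * cnj g = 1" "cnj g * g = 1" using g complex_norm_square[of g] by (simp_all add: mult.commute)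
  define w where "w i = (cnj g * v i - of_real c * u i) / of_real s" for i
  have s0: "complex_of_real s \<noteq> 0" using s by simp
  have uw: "vinner d u w = (cnj g * vinner d u v - of_real c * vinner d u u) / of_real s"
  proof -
    have "cnj (u i) * w i = (cnj g * (cnj (u i) * v i) - of_real c * (cnj (u i) * u i)) / of_real s" for i
      by (simp add: w_def algebra_simps)
    then show ?thesis
      by (simp only: vinner_def sum_divide_distrib[symmetric] sum_subtractf sum_distrib_left[symmetric])
  qed
  also have "\<dots> = 0" using gg unfolding z_def[symmetric] zg u by simp
  finally have uw0: "vinner d u w = 0" .
  have "vinner d w w = (g * cnj g * vinner d v v - of_real c * g * vinner d v u
      - of_real c * cnj g * vinner d u v + of_real c * of_real c * vinner d u u) / (of_real s * of_real s)"
  proof -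
    have "cnj (w i) * w i = (g * cnj g * (cnj (v i) * v i) - of_real c * g * (cnj (v i) * u i)
      - of_real c * cnj g * (cnj (u i) * v i) + of_real c * of_real c * (cnj (u i) * u i))
      / (of_real s * of_real s)" for i
      by (simp add: w_def algebra_simps)
    then show ?thesis
      by (simp only: vinner_def sum_divide_distrib[symmetric] sum.distrib sum_subtractf
          sum_distrib_left[symmetric])
  qed
  also have "\<dots> = (1 - of_real c * of_real c) / (of_real s * of_real s)"
  proof -
    have vu: "vinner d v u = cnj g * of_real c" using zg vinner_commute[of d v u] by (simp add: z_def)
    have uv: "vinner d u v = g * of_real c" using zg by (simp add: z_def)
    show ?thesis unfolding u v vu uv using gg by (simp add: algebra_simps)
  qed
  also have "\<dots> = of_real (1 - c\<^sup>2) / of_real (s\<^sup>2)" by (simp add: power2_eq_square)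
  also have "1 - c\<^sup>2 = s\<^sup>2" using s by simp
  also have "complex_of_real (s\<^sup>2) / of_real (s\<^sup>2) = 1" using s0 by simp
  finally have ww: "vinner d w w = 1" .
  have "v = (\<lambda>i. g * (of_real c * u i + of_real s * w i))"
  proof
    fix i
    have "g * (of_real c * u i + of_real s * w i) = g * cnj g * v i"
      using s0 by (simp add: w_def)
    then show "v i = g * (of_real c * u i + of_real s * w i)" using gg by simp
  qed
  then show ?thesis using that ww uw0 g by blast
qed

text \<open>With \<open>w\<close> completing \<open>u\<close> to an orthonormal basis of the plane,
  the weight at \<open>v\<close> is a mixture of the weights at \<open>u\<close> and
  \<open>w\<close> plus a cross term. Positivity bounds the cross term, and \<open>t\<close> decides
  how it is shared between the weight \<open>p\<close> at \<open>u\<close> and the weight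
  \<open>e\<close> outside \<open>u\<close>.\<close>

lemma quadform_overlap_bounds:
  assumes psd: "psd d A" and u: "vinner d u u = 1" and v: "vinner d v v = 1"
    and c: "cmod (vinner d u v) = c" and s: "0 < s" "c\<^sup>2 + s\<^sup>2 = 1" and t: "0 < t"
  defines "p \<equiv> Re (quadform d A u)" and "q \<equiv> Re (quadform d A v)"
    and "e \<equiv> Re (mtrace d A) - Re (quadform d A u)"
  shows "q \<le> (c\<^sup>2 + t) * p + (s\<^sup>2 + c\<^sup>2 * s\<^sup>2 / t) * e"
    and "(c\<^sup>2 - t) * p - c\<^sup>2 * s\<^sup>2 / t * e \<le> q"
    and "0 \<le> p" and "0 \<le> e"
proof -
  obtain w g where w: "vinner d w w = 1" "vinner d u w = 0" "cmod g = 1"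
    and vw: "v = (\<lambda>i. g * (of_real c * u i + of_real s * w i))"
    using unit_pair_decomposition[OF u v c s] by metis
  define r where "r = Re (quadform d A w)"
  define x where "x = Re (sform d A u w + sform d A w u)"
  have q: "q = c\<^sup>2 * p + s\<^sup>2 * r + c * s * x"
    unfolding q_def vw quadform_scale quadform_combination p_def r_def x_def
    using w(3) by (simp del: of_real_power of_real_mult)
  have pos: "0 \<le> a\<^sup>2 * p + b\<^sup>2 * r + a * b * x" for a b
  proof -
    have "Re (quadform d A (\<lambda>i. of_real a * u i + of_real b * w i)) = a\<^sup>2 * p + b\<^sup>2 * r + a * b * x"
      unfolding quadform_combination p_def r_def x_def
      by (simp del: of_real_power of_real_mult)
    then show ?thesis using psd unfolding psd_def by metis
  qed
  have r: "0 \<le> r" "0 \<le> p" using psd by (simp_all add: psd_def r_def p_def)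
  have re: "r \<le> e" using bessel_quadform[OF psd u disjI1[OF w(1)] w(2)] by (simp add: r_def e_def)
  have sq: "(sqrt t)\<^sup>2 = t" using t by simp
  have ab: "sqrt t * (c * s / sqrt t) = c * s" using t by simp
  have b2: "(c * s / sqrt t)\<^sup>2 = c\<^sup>2 * s\<^sup>2 / t" using sq by (simp add: power_divide power_mult_distrib)
  have m: "c\<^sup>2 * s\<^sup>2 / t * r \<le> c\<^sup>2 * s\<^sup>2 / t * e" "s\<^sup>2 * r \<le> s\<^sup>2 * e"
    using re t by (intro mult_left_mono; simp)+
  \<comment> \<open>The two test vectors are scaled so that the product of their coefficients is -c
    s or c s, matching the cross term in \<open>q\<close>.\<close>
  from pos[of "sqrt t" "- (c * s / sqrt t)"]
  have 1: "c * s * x \<le> t * p + c\<^sup>2 * s\<^sup>2 / t * r"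
    unfolding power2_minus sq b2 mult_minus_right ab by simp
  from pos[of "sqrt t" "c * s / sqrt t"]
  have 2: "- (c * s * x) \<le> t * p + c\<^sup>2 * s\<^sup>2 / t * r"
    unfolding sq b2 ab by simp
  show "q \<le> (c\<^sup>2 + t) * p + (s\<^sup>2 + c\<^sup>2 * s\<^sup>2 / t) * e"
    using q 1 m by (simp add: algebra_simps)
  have "0 \<le> s\<^sup>2 * r" using r by simp
  then show "(c\<^sup>2 - t) * p - c\<^sup>2 * s\<^sup>2 / t * e \<le> q"
    using q 2 m by (simp add: algebra_simps)
  show "0 \<le> p" "0 \<le> e" using r re by auto
qed

text \<open>Bob's marginal state does not depend on his bit, so both decompositions give \<open>v\<close> the
  same weight. Comparing the two values bounds the cheating probability. The error term carries the
  factor \<open>T00 + T10\<close>, which is at most \<open>T\<close> only if \<open>T00 \<le> T11\<close>; otherwise the roles of \<open>u\<close> and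
  \<open>v\<close> have to be exchanged.\<close>

lemma cheating_bound_ordered:
  assumes psd: "psd d S00" "psd d S01" "psd d S10" "psd d S11"
    and tr: "Re (mtrace d S00) + Re (mtrace d S01) = T" "Re (mtrace d S10) + Re (mtrace d S11) = T"
    and marg: "Re (quadform d S00 v) + Re (quadform d S01 v) = Re (quadform d S10 v) + Re (quadform d S11 v)"
    and u: "vinner d u u = 1" and v: "vinner d v v = 1"
    and c: "cmod (vinner d u v) = c" and s: "0 < s" "c\<^sup>2 + s\<^sup>2 = 1" and t: "0 < t"
    and le: "Re (mtrace d S00) \<le> Re (mtrace d S11)"
    and E: "E = (Re (mtrace d S00) - Re (quadform d S00 u)) + (Re (mtrace d S01) - Re (quadform d S01 v))
       + (Re (mtrace d S10) - Re (quadform d S10 u)) + (Re (mtrace d S11) - Re (quadform d S11 v))"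
  shows "s\<^sup>2 * (Re (mtrace d S00) + Re (mtrace d S11) - T) \<le> t * T + E / (4 * t) + E"
proof -
  define T00 T01 T10 T11 where Ts: "T00 = Re (mtrace d S00)" "T01 = Re (mtrace d S01)"
    "T10 = Re (mtrace d S10)" "T11 = Re (mtrace d S11)"
  define p00 p10 where ps: "p00 = Re (quadform d S00 u)" "p10 = Re (quadform d S10 u)"
  define q00 q01 q10 q11 where qs: "q00 = Re (quadform d S00 v)" "q01 = Re (quadform d S01 v)"
    "q10 = Re (quadform d S10 v)" "q11 = Re (quadform d S11 v)"
  define k where "k = c\<^sup>2 * s\<^sup>2 / t"
  note defs = Ts ps qs k_def
  have c': "cmod (vinner d v u) = c" using c vinner_commute[of d v u] by simp
  have b00: "q00 \<le> (c\<^sup>2 + t) * p00 + (s\<^sup>2 + k) * (T00 - p00)" "0 \<le> p00" "0 \<le> T00 - p00"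
    using quadform_overlap_bounds[OF psd(1) u v c s t] by (simp_all add: defs)
  have b10: "(c\<^sup>2 - t) * p10 - k * (T10 - p10) \<le> q10" "0 \<le> p10" "0 \<le> T10 - p10"
    using quadform_overlap_bounds[OF psd(3) u v c s t] by (simp_all add: defs)
  have b01: "0 \<le> T01 - q01"
    using quadform_overlap_bounds(4)[OF psd(2) v u c' s t] by (simp add: defs)
  have b11: "0 \<le> T11 - q11"
    using quadform_overlap_bounds(4)[OF psd(4) v u c' s t] by (simp add: defs)
  have E': "E = (T00 - p00) + (T01 - q01) + (T10 - p10) + (T11 - q11)"
    using E by (simp add: defs)
  have T: "T01 = T - T00" "T10 = T - T11" "q01 = q10 + q11 - q00" using tr marg by (simp_all add: defs)
  have c2: "c\<^sup>2 = 1 - s\<^sup>2" using s by simp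
  have s1: "0 \<le> s\<^sup>2" by simp
  have s1': "s\<^sup>2 \<le> 1" using s(2) zero_le_power2[of c] by linarith
  \<comment> \<open>Here c^2 s^2 = s^2 (1 - s^2); its maximum 1/4 is the origin of the 4 in E / (4
    t).\<close>
  have "c\<^sup>2 * s\<^sup>2 \<le> 1 / 4"
  proof -
    have "0 \<le> (s\<^sup>2 - 1/2)\<^sup>2" by simp
    then show ?thesis unfolding c2 by (simp add: power2_eq_square algebra_simps)
  qed
  then have k: "k \<le> 1 / (4 * t)" using t by (simp add: k_def field_simps)
  have tp: "t * p00 + t * p10 \<le> t * T"
  proof -
    have "p00 + p10 \<le> T" using b00 b10 T le by (simp add: Ts)
    then show ?thesis using t by (metis distrib_left mult_left_mono less_imp_le)
  qed
  have e: "0 \<le> T00 - p00 + (T10 - p10)" "T00 - p00 + (T10 - p10) \<le> E"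
    using b00 b10 b01 b11 E' by auto
  have ke: "k * (T00 - p00 + (T10 - p10)) \<le> E / (4 * t)"
    using mult_mono[OF k e(2)] e t by simp
  have s2e: "0 \<le> s\<^sup>2 * (T10 - p10)" "s\<^sup>2 * (T00 - p00) \<le> T00 - p00"
    using s1 s1' b10 b00 by (auto intro: mult_left_le_one_le)
  \<comment> \<open>Without errors, \<open>q00\<close>, \<open>q01\<close>, \<open>q10\<close>,
    \<open>q11\<close> would be c^2 T00, T01, c^2 T10, T11, and the equality of the marginals at
    \<open>v\<close> would read s^2 (T00 + T11 - T) = 0. The inequality is this computation with the
    errors kept.\<close>
  have "s\<^sup>2 * (T00 + T11 - T) \<le> t * p00 + t * p10 + k * (T00 - p00 + (T10 - p10))
      + (T11 - q11) + (T10 - p10) - s\<^sup>2 * (T10 - p10)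
      + 2 * (s\<^sup>2 * (T00 - p00)) - (T00 - p00) - (T01 - q01)"
    using b00(1) b10(1) unfolding T c2 by (simp add: algebra_simps)
  also have "\<dots> \<le> t * T + E / (4 * t) + E"
    using tp ke s2e b01 b00 b10 b11 E' by linarith
  finally show ?thesis by (simp add: defs)
qed

text \<open>Exchanging \<open>u\<close> with \<open>v\<close> and 0 with 1 in both indices preserves
  the hypotheses, \<open>E\<close> and the conclusion, so the order of the two favourable weights
  may be assumed. In the exchanged case the marginals are compared at \<open>u\<close>.\<close>

lemma cheating_bound:
  assumes psd: "psd d S00" "psd d S01" "psd d S10" "psd d S11"
    and tr: "Re (mtrace d S00) + Re (mtrace d S01) = T" "Re (mtrace d S10) + Re (mtrace d S11) = T"
    and marg: "\<And>x. Re (quadform d S00 x) + Re (quadform d S01 x) = Re (quadform d S10 x) + Re (quadform d S11 x)"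
    and u: "vinner d u u = 1" and v: "vinner d v v = 1"
    and c: "cmod (vinner d u v) = c" and s: "0 < s" "c\<^sup>2 + s\<^sup>2 = 1" and t: "0 < t"
    and E: "E = (Re (mtrace d S00) - Re (quadform d S00 u)) + (Re (mtrace d S01) - Re (quadform d S01 v))
       + (Re (mtrace d S10) - Re (quadform d S10 u)) + (Re (mtrace d S11) - Re (quadform d S11 v))"
  shows "s\<^sup>2 * (Re (mtrace d S00) + Re (mtrace d S11) - T) \<le> t * T + E / (4 * t) + E"
proof (cases "Re (mtrace d S00) \<le> Re (mtrace d S11)")
  case True
  show ?thesis by (rule cheating_bound_ordered[OF psd tr marg u v c s t True E])
next
  case False
  have c': "cmod (vinner d v u) = c" using c vinner_commute[of d v u] by simp
  have "s\<^sup>2 * (Re (mtrace d S11) + Re (mtrace d S00) - T) \<le> t * T + E / (4 * t) + E"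
    using tr marg[of u] False E
    by (intro cheating_bound_ordered[OF psd(4,3,2,1) _ _ _ v u c' s t]) auto
  then show ?thesis by (simp add: add.commute)
qed

subsection \<open>One round against a dishonest Alice\<close>

definition outbit :: "round \<Rightarrow> bool" where "outbit r = (case r of (a, b, f) \<Rightarrow> a \<noteq> b)"
definition flag :: "round \<Rightarrow> bool" where "flag r = (case r of (a, b, f) \<Rightarrow> f)"

lemma sum_round: "(\<Sum>r\<in>(UNIV::round set). F r) =
   (\<Sum>a\<in>UNIV. \<Sum>b\<in>UNIV. \<Sum>f\<in>UNIV. F (a, b, f))"
  by (simp add: UNIV_Times_UNIV[symmetric] sum.cartesian_product' del: UNIV_Times_UNIV)

text \<open>The conditions are multiplied by the weight \<open>p t\<close> of the prefix, so nothing
  is divided by a probability that may vanish. In \<open>p_step\<close> the failures are summed over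
  both output bits, because the one-round bound cannot attribute them to \<open>y\<close>.\<close>

locale string_process =
  fixes p :: "round list \<Rightarrow> real" and \<alpha> \<beta> :: real
  assumes p_Nil: "p [] = 1"
    and p_nonneg: "0 \<le> p t"
    and p_total: "(\<Sum>r\<in>UNIV. p (t @ [r])) = p t"
    and p_step: "(\<Sum>r | outbit r = y. p (t @ [r])) \<le> (1/2 + \<beta>) * p t + \<alpha> * (\<Sum>r | \<not> flag r. p (t @ [r]))"
    and coeffs: "0 < \<alpha>" "0 \<le> \<beta>"

lemma sum_outbit: "(\<Sum>r | outbit r = y. F r) = (\<Sum>f\<in>UNIV. F (False, y, f)) + (\<Sum>f\<in>UNIV. F (True, \<not> y, f))"
proof -
  have "(\<Sum>r | outbit r = y. F r) = (\<Sum>r\<in>UNIV. if outbit r = y then F r else 0)"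
    by (simp add: sum.If_cases)
  then show ?thesis unfolding sum_round by (cases y) (auto simp: UNIV_bool outbit_def algebra_simps)
qed

lemma sum_failed: "(\<Sum>r | \<not> flag r. F r) = (\<Sum>a\<in>UNIV. \<Sum>b\<in>UNIV. F (a, b, False))"
proof -
  have "(\<Sum>r | \<not> flag r. F r) = (\<Sum>r\<in>UNIV. if \<not> flag r then F r else 0)"
    by (simp add: sum.If_cases)
  then show ?thesis unfolding sum_round by (simp add: UNIV_bool flag_def)
qed

lemma bproj_idempotent:
  assumes "unitvec d (\<psi> a)" "k < d" "l < d"
  shows "(\<Sum>j<d. bproj d \<psi> a f k j * bproj d \<psi> a f j l) = bproj d \<psi> a f k l"
proof -
  have pp: "(\<Sum>j<d. proj (\<psi> a) k j * proj (\<psi> a) j l) = proj (\<psi> a) k l"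
  proof -
    have "(\<Sum>j<d. proj (\<psi> a) k j * proj (\<psi> a) j l) = \<psi> a k * cnj (\<psi> a l) * vinner d (\<psi> a) (\<psi> a)"
      unfolding vinner_def sum_distrib_left by (intro sum.cong refl) (simp add: proj_def mult_ac)
    then show ?thesis using vinner_unit[OF assms(1)] by (simp add: proj_def)
  qed
  show ?thesis
  proof (cases f)
    case True
    then show ?thesis using pp by (simp add: bproj_def)
  next
    case False
    have "(\<Sum>j<d. (idm d k j - proj (\<psi> a) k j) * (idm d j l - proj (\<psi> a) j l))
       = (\<Sum>j<d. idm d k j * (idm d j l - proj (\<psi> a) j l)) - (\<Sum>j<d. idm d j l * proj (\<psi> a) k j)
         + (\<Sum>j<d. proj (\<psi> a) k j * proj (\<psi> a) j l)"
      unfolding sum_subtractf[symmetric] sum.distrib[symmetric] by (simp add: algebra_simps)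
    also have "\<dots> = idm d k l - proj (\<psi> a) k l"
      unfolding sum_idm sum_idm' pp using assms by simp
    finally show ?thesis using False by (simp add: bproj_def)
  qed
qed

lemma adj_kron_bproj: "adj (kron d d (idm m) (bproj d \<psi> a f)) = kron d d (idm m) (bproj d \<psi> a f)"
  by (auto simp: adj_def kron_def idm_def bproj_def proj_def fun_eq_iff)

lemma bproj_weight:
  "(\<Sum>k<d. \<Sum>l<d. bproj d \<psi> a f l k * A k l) =
    (if f then quadform d A (\<psi> a) else mtrace d A - quadform d A (\<psi> a))"
proof -
  have 1: "(\<Sum>k<d. \<Sum>l<d. proj (\<psi> a) l k * A k l) = quadform d A (\<psi> a)"
    unfolding quadform_def by (intro sum.cong refl) (simp add: proj_def mult_ac)
  have "(\<Sum>k<d. \<Sum>l<d. (idm d l k - proj (\<psi> a) l k) * A k l) = mtrace d A - quadform d A (\<psi> a)"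
    unfolding left_diff_distrib sum_subtractf 1 sum_idm_quadratic ..
  then show ?thesis using 1 by (simp add: bproj_def)
qed

lemma quadform_cong:
  assumes "\<And>k l. k < d \<Longrightarrow> l < d \<Longrightarrow> A k l = B k l"
  shows "quadform d A v = quadform d B v"
  unfolding quadform_def using assms by (intro sum.cong refl) simp

text \<open>Joint state of memory and sent system between Alice's answer and Bob's test; the factor
  1/2 for Bob's random bit is not included.\<close>

definition round_state :: "nat \<Rightarrow> (bool \<Rightarrow> cvec) \<Rightarrow> astrat \<Rightarrow> round list \<Rightarrow> bool \<Rightarrow> bool \<Rightarrow> cmat" where
  "round_state d \<psi> S h b a =
     kapply (amem S * d) (map (\<lambda>K. kron d d K (idm d)) (ameas S (map (\<lambda>(a, b, f). (a, b)) h) b a))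
       (kapply (amem S) (aprep S (map (\<lambda>(a, b, f). (a, b)) h)) (stA d \<psi> S h))"

text \<open>The unnormalised state of the system sent to Bob, after he announced \<open>b\<close> and Alice
  answered \<open>a\<close>.\<close>
definition sent_state :: "nat \<Rightarrow> (bool \<Rightarrow> cvec) \<Rightarrow> astrat \<Rightarrow> round list \<Rightarrow> bool \<Rightarrow> bool \<Rightarrow> cmat" where
  "sent_state d \<psi> S h b a = ptr1 (amem S) d (round_state d \<psi> S h b a)"

lemma stA_Cons: "stA d \<psi> S ((a, b, f) # h) =
   (let P = kron d d (idm (amem S)) (bproj d \<psi> a f)
    in (\<lambda>i j. ptrace2 d (mmul (amem S * d) (mmul (amem S * d) P (round_state d \<psi> S h b a)) P) i j / 2))"
  by (simp add: round_state_def Let_def)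

lemma psd_stA:
  assumes "valid_astrat d S"
  shows "psd (amem S) (stA d \<psi> S h)"
proof (induction h)
  case Nil
  then show ?case using assms by (simp add: valid_astrat_def density_def psd_def)
next
  case (Cons r h)
  obtain a b f where r: "r = (a, b, f)" by (cases r)
  let ?P = "kron d d (idm (amem S)) (bproj d \<psi> a f)"
  have "psd (amem S * d) (kapply (amem S * d) [?P] (round_state d \<psi> S h b a))"
    unfolding round_state_def by (intro psd_kapply Cons)
  also have "kapply (amem S * d) [?P] (round_state d \<psi> S h b a)
     = mmul (amem S * d) (mmul (amem S * d) ?P (round_state d \<psi> S h b a)) ?P"
    by (simp add: kapply_def adj_kron_bproj)
  finally show ?case
    unfolding r stA_Cons Let_def
    by (auto simp: psd_def[of "amem S"] quadform_divide dest!: psd_ptrace2)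
qed

lemma psd_sent_state:
  assumes "valid_astrat d S"
  shows "psd d (sent_state d \<psi> S h b a)"
  unfolding sent_state_def round_state_def by (intro psd_ptr1 psd_kapply psd_stA assms)

lemma mtrace_stA_Cons:
  assumes "unitvec d (\<psi> a)"
  shows "mtrace (amem S) (stA d \<psi> S ((a, b, f) # h)) =
    (if f then quadform d (sent_state d \<psi> S h b a) (\<psi> a)
     else mtrace d (sent_state d \<psi> S h b a) - quadform d (sent_state d \<psi> S h b a) (\<psi> a)) / 2"
proof -
  have "mtrace (amem S) (stA d \<psi> S ((a, b, f) # h)) =
    mtrace (amem S) (ptrace2 d (mmul (amem S * d) (mmul (amem S * d) (kron d d (idm (amem S)) (bproj d \<psi> a f))
       (round_state d \<psi> S h b a)) (kron d d (idm (amem S)) (bproj d \<psi> a f)))) / 2"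
    unfolding stA_Cons Let_def mtrace_def by (rule sum_divide_distrib[symmetric])
  then show ?thesis
    using bproj_idempotent[of d \<psi> a, OF assms] by (simp add: mtrace_projected bproj_weight sent_state_def)
qed

text \<open>Summing over Alice's answers makes the Kraus sums of her instrument add up to the
  identity. The right-hand side does not mention \<open>b\<close>: Bob's reduced state is fixed
  before he announces his bit.\<close>

lemma sent_state_marginal:
  assumes "valid_astrat d S" "k < d" "l < d"
  shows "sent_state d \<psi> S h b False k l + sent_state d \<psi> S h b True k l =
    ptr1 (amem S) d (kapply (amem S) (aprep S (map (\<lambda>(a, b, f). (a, b)) h)) (stA d \<psi> S h)) k l"
    (is "_ = ptr1 _ _ ?X k l")
proof -
  let ?h = "map (\<lambda>(a, b, f). (a, b)) h" and ?m = "amem S"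
  have inst: "instrument2 ?m ?m (ameas S ?h b)" using assms by (simp add: valid_astrat_def)
  have "sent_state d \<psi> S h b False k l + sent_state d \<psi> S h b True k l
    = (\<Sum>i<?m. \<Sum>j<?m. (\<Sum>a\<in>UNIV. kraus_sum ?m (ameas S ?h b a) j i) * ?X (i * d + k) (j * d + l))"
    unfolding sent_state_def round_state_def ptr1_kapply_kron[OF assms(2,3)]
    by (simp add: UNIV_bool sum.distrib distrib_right add.commute)
  also have "\<dots> = mtrace ?m (\<lambda>i j. ?X (i * d + k) (j * d + l))"
    unfolding instrument2_sum[OF inst] by (rule sum_idm_quadratic)
  finally show ?thesis by (simp add: mtrace_def ptr1_def)
qed

lemma sent_state_quadform:
  assumes "valid_astrat d S"
  shows "quadform d (sent_state d \<psi> S h b False) v + quadform d (sent_state d \<psi> S h b True) v =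
    quadform d (ptr1 (amem S) d (kapply (amem S) (aprep S (map (\<lambda>(a, b, f). (a, b)) h)) (stA d \<psi> S h))) v"
  unfolding quadform_add[symmetric]
  by (rule quadform_cong) (rule sent_state_marginal[OF assms])

lemma sent_state_mtrace:
  assumes "valid_astrat d S"
  shows "mtrace d (sent_state d \<psi> S h b False) + mtrace d (sent_state d \<psi> S h b True)
      = mtrace (amem S) (stA d \<psi> S h)"
proof -
  let ?X = "kapply (amem S) (aprep S (map (\<lambda>(a, b, f). (a, b)) h)) (stA d \<psi> S h)"
  have "mtrace d (sent_state d \<psi> S h b False) + mtrace d (sent_state d \<psi> S h b True)
     = mtrace d (ptr1 (amem S) d ?X)"
    unfolding mtrace_def sum.distrib[symmetric]
    using sent_state_marginal[OF assms] by (intro sum.cong refl) simp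
  also have "\<dots> = mtrace (amem S) (stA d \<psi> S h)"
    unfolding mtrace_ptr1 using assms
    by (intro mtrace_kapply_cptp) (simp add: valid_astrat_def)
  finally show ?thesis .
qed

lemma string_process_probA:
  assumes u: "unitvec d (\<psi> False)" and v: "unitvec d (\<psi> True)"
    and c: "cmod (vinner d (\<psi> False) (\<psi> True)) = c" and s: "0 < s" "c\<^sup>2 + s\<^sup>2 = 1" and t: "0 < t"
    and S: "valid_astrat d S"
  shows "string_process (probA d \<psi> S) (1 / (4 * t * s\<^sup>2) + 1 / s\<^sup>2) (t / (2 * s\<^sup>2))"
proof
  have unit: "unitvec d (\<psi> a)" for a using u v by (cases a) auto
  let ?\<sigma> = "\<lambda>x. sent_state d \<psi> S (rev x)"
  define T where "T x b a = Re (mtrace d (?\<sigma> x b a))" for x b a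
  define q where "q x b a = Re (quadform d (?\<sigma> x b a) (\<psi> a))" for x b a
  have snoc: "probA d \<psi> S (x @ [(a, b, f)]) = (if f then q x b a else T x b a - q x b a) / 2" for x a b f
    by (simp add: probA_def mtrace_stA_Cons unit T_def q_def del: stA.simps)
  have tot: "T x b False + T x b True = probA d \<psi> S x" for x b
    using arg_cong[OF sent_state_mtrace[OF S, of \<psi> "rev x" b], of Re] by (simp add: T_def probA_def)
  show "probA d \<psi> S [] = 1"
    using S by (simp add: probA_def valid_astrat_def density_def)
  show "0 \<le> probA d \<psi> S x" for x
    unfolding probA_def by (intro psd_mtrace_nonneg psd_stA S)
  show "(\<Sum>r\<in>UNIV. probA d \<psi> S (x @ [r])) = probA d \<psi> S x" for x
    unfolding sum_round using tot[of x True] tot[of x False] by (simp add: UNIV_bool snoc field_simps)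
  show "0 < 1 / (4 * t * s\<^sup>2) + 1 / s\<^sup>2" "0 \<le> t / (2 * s\<^sup>2)"
    using s t by (simp_all add: add_pos_pos)
  fix x y
  define E where "E = (T x y False - q x y False) + (T x y True - q x y True)
     + (T x (\<not> y) False - q x (\<not> y) False) + (T x (\<not> y) True - q x (\<not> y) True)"
  \<comment> \<open>The bit \<open>b\<close> is read relative to \<open>y\<close>: first index 0
    means b = y, first index 1 its negation, and the second index is \<open>a\<close>. The output
    bit is \<open>y\<close> exactly for 00 and 11, the combination that
    \<open>cheating_bound\<close> controls.\<close>
  have "s\<^sup>2 * (T x y False + T x (\<not> y) True - probA d \<psi> S x)
      \<le> t * probA d \<psi> S x + E / (4 * t) + E"
    unfolding T_def
  proof (rule cheating_bound[OF _ _ _ _ _ _ _ vinner_unit[OF u] vinner_unit[OF v] c s t])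
    fix w
    show "Re (quadform d (?\<sigma> x y False) w) + Re (quadform d (?\<sigma> x y True) w) =
          Re (quadform d (?\<sigma> x (\<not> y) False) w) + Re (quadform d (?\<sigma> x (\<not> y) True) w)"
      unfolding plus_complex.sel[symmetric] sent_state_quadform[OF S] ..
  next
    show "E = Re (mtrace d (?\<sigma> x y False)) - Re (quadform d (?\<sigma> x y False) (\<psi> False)) +
      (Re (mtrace d (?\<sigma> x y True)) - Re (quadform d (?\<sigma> x y True) (\<psi> True))) +
      (Re (mtrace d (?\<sigma> x (\<not> y) False)) - Re (quadform d (?\<sigma> x (\<not> y) False) (\<psi> False))) +
      (Re (mtrace d (?\<sigma> x (\<not> y) True)) - Re (quadform d (?\<sigma> x (\<not> y) True) (\<psi> True)))"
      by (simp add: E_def T_def q_def)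
  qed (use tot[of x] in \<open>auto simp: T_def intro: psd_sent_state[OF S]\<close>)
  then have "T x y False + T x (\<not> y) True - probA d \<psi> S x
      \<le> (t * probA d \<psi> S x + E / (4 * t) + E) / s\<^sup>2"
    using s by (simp add: pos_le_divide_eq mult.commute)
  then have "(T x y False + T x (\<not> y) True) / 2
      \<le> (probA d \<psi> S x + (t * probA d \<psi> S x + E / (4 * t) + E) / s\<^sup>2) / 2"
    by (intro divide_right_mono) (metis diff_le_eq add.commute, simp)
  also have "\<dots> = (1/2 + t / (2 * s\<^sup>2)) * probA d \<psi> S x + (1 / (4 * t * s\<^sup>2) + 1 / s\<^sup>2) * (E / 2)"
    by (simp add: algebra_simps add_divide_distrib)
  \<comment> \<open>The 1/2 is the probability of each value of Bob's bit, which the states in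
    \<open>E\<close> omit.\<close>
  also have "E / 2 = (\<Sum>r | \<not> flag r. probA d \<psi> S (x @ [r]))"
    unfolding sum_failed by (cases y) (simp_all add: UNIV_bool snoc E_def field_simps)
  also have "(T x y False + T x (\<not> y) True) / 2 = (\<Sum>r | outbit r = y. probA d \<psi> S (x @ [r]))"
    unfolding sum_outbit by (simp add: UNIV_bool snoc field_simps)
  finally show "(\<Sum>r | outbit r = y. probA d \<psi> S (x @ [r])) \<le> (1/2 + t / (2 * s\<^sup>2)) * probA d \<psi> S x
      + (1 / (4 * t * s\<^sup>2) + 1 / s\<^sup>2) * (\<Sum>r | \<not> flag r. probA d \<psi> S (x @ [r]))" .
qed

subsection \<open>Concentration along transcripts\<close>

lemma finite_lists_length_UNIV: "finite {t :: 'r::finite list. length t = n}"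
  using finite_lists_length_eq[of "UNIV :: 'r set" n] by simp

lemma sum_lists_length_Suc:
  fixes f :: "'r::finite list \<Rightarrow> 'a::comm_monoid_add"
  shows "(\<Sum>t | length t = Suc n. f t) = (\<Sum>t | length t = n. \<Sum>r\<in>UNIV. f (t @ [r]))"
proof -
  have "(\<Sum>t | length t = n. \<Sum>r\<in>UNIV. f (t @ [r])) = (\<Sum>(t, r)\<in>{t. length t = n} \<times> UNIV. f (t @ [r]))"
    by (rule sum.cartesian_product)
  also have "\<dots> = (\<Sum>t | length t = Suc n. f t)"
    by (rule sum.reindex_bij_witness[where i = "\<lambda>t. (butlast t, last t)" and j = "\<lambda>(t, r). t @ [r]"])
       (auto simp: length_0_conv[symmetric] simp del: length_0_conv)
  finally show ?thesis ..
qed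

text \<open>The factor of a round may depend on all earlier rounds. Summed against \<open>p\<close>,
  this is the expectation of a multiplicative process, a supermartingale after rescaling when the
  one-round inequality holds.\<close>

definition pathprod :: "('r list \<Rightarrow> 'r \<Rightarrow> real) \<Rightarrow> 'r list \<Rightarrow> real" where
  "pathprod \<phi> t = (\<Prod>i<length t. \<phi> (take i t) (t ! i))"

lemma pathprod_snoc: "pathprod \<phi> (t @ [r]) = pathprod \<phi> t * \<phi> t r"
proof -
  have "(\<Prod>i<length t. \<phi> (take i (t @ [r])) ((t @ [r]) ! i)) = pathprod \<phi> t"
    unfolding pathprod_def by (intro prod.cong refl) (simp add: nth_append)
  then show ?thesis by (simp add: pathprod_def)
qed

lemma sum_pathprod_eq:
  fixes p :: "'r::finite list \<Rightarrow> real"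
  assumes "\<And>t. length t < n \<Longrightarrow> (\<Sum>r\<in>UNIV. p (t @ [r]) * \<phi> t r) = M * p t"
  shows "(\<Sum>t | length t = n. p t * pathprod \<phi> t) = M ^ n * p []"
  using assms
proof (induction n)
  case 0
  then show ?case by (simp add: pathprod_def)
next
  case (Suc n)
  have "(\<Sum>t | length t = Suc n. p t * pathprod \<phi> t)
     = (\<Sum>t | length t = n. pathprod \<phi> t * (\<Sum>r\<in>UNIV. p (t @ [r]) * \<phi> t r))"
    by (simp add: sum_lists_length_Suc pathprod_snoc sum_distrib_left mult_ac)
  also have "\<dots> = (\<Sum>t | length t = n. M * (p t * pathprod \<phi> t))"
    by (intro sum.cong refl) (simp add: Suc.prems)
  also have "\<dots> = M * (M ^ n * p [])"
    unfolding sum_distrib_left[symmetric] by (subst Suc.IH) (auto simp: Suc.prems)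
  finally show ?case by simp
qed

lemma sum_pathprod_le:
  fixes p :: "'r::finite list \<Rightarrow> real"
  assumes "\<And>t. length t < n \<Longrightarrow> (\<Sum>r\<in>UNIV. p (t @ [r]) * \<phi> t r) \<le> M * p t"
    and \<phi>: "\<And>t r. 0 \<le> \<phi> t r" and M: "0 \<le> M"
  shows "(\<Sum>t | length t = n. p t * pathprod \<phi> t) \<le> M ^ n * p []"
  using assms(1)
proof (induction n)
  case 0
  then show ?case by (simp add: pathprod_def)
next
  case (Suc n)
  have "(\<Sum>t | length t = Suc n. p t * pathprod \<phi> t)
     = (\<Sum>t | length t = n. pathprod \<phi> t * (\<Sum>r\<in>UNIV. p (t @ [r]) * \<phi> t r))"
    by (simp add: sum_lists_length_Suc pathprod_snoc sum_distrib_left mult_ac)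
  also have "\<dots> \<le> (\<Sum>t | length t = n. pathprod \<phi> t * (M * p t))"
    by (intro sum_mono mult_left_mono) (auto simp: Suc.prems pathprod_def intro!: prod_nonneg \<phi>)
  also have "\<dots> = M * (\<Sum>t | length t = n. p t * pathprod \<phi> t)"
    by (simp add: sum_distrib_left mult_ac)
  also have "\<dots> \<le> M * (M ^ n * p [])"
    using M Suc.prems by (intro mult_left_mono Suc.IH) auto
  finally show ?case by simp
qed

text \<open>The product (1 - l + l^2/2) (1 + l + l^2/2) equals 1 + l^4/4, and the second factor is
  at most exp l.\<close>

lemma exp_minus_le_quadratic:
  fixes l :: real
  assumes "0 \<le> l"
  shows "exp (- l) \<le> 1 - l + l\<^sup>2 / 2"
proof -
  have pos: "0 < 1 + l + l\<^sup>2 / 2" using assms by (simp add: add_pos_nonneg)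
  have "0 \<le> (l\<^sup>2)\<^sup>2" by simp
  then have "1 \<le> (1 - l + l\<^sup>2 / 2) * (1 + l + l\<^sup>2 / 2)"
    by (simp add: power2_eq_square algebra_simps)
  then have "1 / (1 + l + l\<^sup>2 / 2) \<le> 1 - l + l\<^sup>2 / 2" using pos by (simp add: pos_divide_le_eq)
  moreover have "exp (- l) \<le> 1 / (1 + l + l\<^sup>2 / 2)"
    using exp_lower_Taylor_quadratic[OF assms] pos by (simp add: exp_minus field_simps)
  ultimately show ?thesis by linarith
qed

lemma exp_le_quadratic:
  fixes x :: real
  assumes "x \<le> 1"
  shows "exp x \<le> 1 + x + x\<^sup>2"
proof (cases "0 \<le> x")
  case True
  then show ?thesis using assms exp_bound by blast
next
  case False
  then have "exp x \<le> 1 + x + x\<^sup>2 / 2" using exp_minus_le_quadratic[of "- x"] by simp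
  then show ?thesis using zero_le_power2[of x] by linarith
qed

text \<open>A weak form of Hoeffding's lemma, with l^2/2 in place of l^2/8; it is strong enough for
  the exponent claimed for correctness.\<close>

lemma bernoulli_mgf_le:
  fixes x l :: real
  assumes "0 \<le> x" "x \<le> 1" "0 \<le> l"
  shows "1 - x + x * exp (- l) \<le> exp (- l * x + l\<^sup>2 / 2)"
proof -
  have "x * exp (- l) \<le> x * (1 - l + l\<^sup>2 / 2)"
    using assms by (intro mult_left_mono exp_minus_le_quadratic) auto
  moreover have "x * (l\<^sup>2 / 2) \<le> l\<^sup>2 / 2" using assms by (intro mult_left_le_one_le) auto
  ultimately have "1 - x + x * exp (- l) \<le> 1 + (- l * x + l\<^sup>2 / 2)"
    by (simp add: algebra_simps)
  also have "\<dots> \<le> exp (- l * x + l\<^sup>2 / 2)" by (rule exp_ge_add_one_self)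
  finally show ?thesis .
qed

lemma nth_xor_out: "i < length t \<Longrightarrow> xor_out t ! i = outbit (t ! i)"
  by (simp add: xor_out_def outbit_def)

lemma xor_out_eq_iff:
  "length t = n \<Longrightarrow> length c = n \<Longrightarrow> xor_out t = c \<longleftrightarrow> (\<forall>i<n. outbit (t ! i) = c ! i)"
  by (auto simp: list_eq_iff_nth_eq nth_xor_out) (simp_all add: xor_out_def outbit_def)

lemma length_filter_flag:
  "real (length (filter (\<lambda>(a, b, f). f) t)) = (\<Sum>i<length t. if flag (t ! i) then 1 else 0)"
proof -
  have "real (length (filter (\<lambda>(a, b, f). f) t)) = real (card {i. i < length t \<and> flag (t ! i)})"
    by (simp add: length_filter_conv_card flag_def)
  also have "\<dots> = (\<Sum>i<length t. if flag (t ! i) then 1 else 0)"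
    by (simp add: sum.If_cases) (simp add: Int_def)
  finally show ?thesis .
qed

lemma accepts_iff:
  "accepts fstar t \<longleftrightarrow> (\<Sum>i<length t. if flag (t ! i) then 0 else 1) \<le> real (length t) * (1 - fstar)"
proof -
  have "(\<Sum>i<length t. if flag (t ! i) then 0 else 1) = (\<Sum>i<length t. (1::real) - (if flag (t ! i) then 1 else 0))"
    by (intro sum.cong) auto
  also have "\<dots> = real (length t) - real (length (filter (\<lambda>(a, b, f). f) t))"
    unfolding length_filter_flag by (simp add: sum_subtractf)
  finally show ?thesis by (auto simp: accepts_def algebra_simps)
qed

lemma sum_Collect_if:
  fixes F :: "'r::finite \<Rightarrow> real"
  shows "(\<Sum>r | P r. F r) = (\<Sum>r\<in>UNIV. F r * (if P r then 1 else 0))"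
  by (rule sum.mono_neutral_cong_left) auto

section \<open>Exponential bounds for accepted transcripts\<close>

context string_process
begin

lemma p_total_length: "(\<Sum>t | length t = n. p t) = 1"
  using sum_pathprod_eq[of n p "\<lambda>_ _. 1" 1] by (simp add: p_total p_Nil pathprod_def)

text \<open>The sum \<open>Z\<close> of the increments has nonpositive mean, but only accepted
  transcripts count and \<open>Z\<close> may be very negative on the others, so its positive part
  must be controlled. Since exp (l Z) / l dominates that part, an exponential moment
  suffices.\<close>

lemma accepted_matches_le:
  fixes fstar :: real and c :: "bool list"
  assumes n: "1 \<le> n" and fstar: "fstar \<le> 1"
  defines "G \<equiv> 1/2 + \<beta> + \<alpha> * (1 - fstar)" and "K \<equiv> 2 + \<alpha> + \<beta>"
  shows "(\<Sum>t | length t = n. p t * (if accepts fstar t then \<Sum>i<n. if outbit (t ! i) = c ! i then 1 else 0 else 0))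
     \<le> real n * G + exp 1 * K * sqrt (real n)"
proof -
  \<comment> \<open>As \<open>K\<close> bounds the increments, each round multiplies the moment by
    at most 1 + (l K)^2 = 1 + 1/n. Over n rounds this stays below exp 1, and the final division by
    \<open>l\<close> costs K sqrt n.\<close>
  define l where "l = 1 / (K * sqrt (real n))"
  have K: "2 \<le> K" using coeffs by (simp add: K_def)
  have l0: "0 < l" using K n by (simp add: l_def)
  have "K \<le> K * sqrt (real n)" using K n by (simp add: mult_le_cancel_left1)
  then have lK: "l * K \<le> 1" using K n by (simp add: l_def divide_le_eq)
  have lK2: "(l * K)\<^sup>2 = 1 / real n" using K n by (simp add: l_def power_divide power_mult_distrib)
  define z where "z i r = (if outbit r = c ! i then 1 else 0) - \<alpha> * (if flag r then 0 else 1) - (1/2 + \<beta>)"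
    for i r
  define \<phi> where "\<phi> t r = exp (l * z (length t) r)" for t :: "round list" and r
  have z: "\<bar>z i r\<bar> \<le> K" for i r using coeffs by (auto simp: z_def K_def)
  have \<phi>: "\<phi> t r \<le> 1 + l * z (length t) r + 1 / real n" for t r
  proof -
    have "\<bar>l * z (length t) r\<bar> \<le> l * K" using z l0 by (simp add: abs_mult)
    then have "l * z (length t) r \<le> 1" "(l * z (length t) r)\<^sup>2 \<le> (l * K)\<^sup>2"
      using lK power2_le_iff_abs_le[of "l * K" "l * z (length t) r"] by auto
    then show ?thesis using exp_le_quadratic[of "l * z (length t) r"] unfolding \<phi>_def lK2 by linarith
  qed
  have drift: "(\<Sum>r\<in>UNIV. p (t @ [r]) * z (length t) r) \<le> 0" for t
  proof -
    have "(\<Sum>r\<in>UNIV. p (t @ [r]) * z (length t) r) =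
       (\<Sum>r | outbit r = c ! length t. p (t @ [r])) - \<alpha> * (\<Sum>r | \<not> flag r. p (t @ [r]))
       - (1/2 + \<beta>) * (\<Sum>r\<in>UNIV. p (t @ [r]))"
      unfolding sum_Collect_if sum_distrib_left sum_subtractf[symmetric]
      by (intro sum.cong refl) (simp add: z_def algebra_simps)
    then show ?thesis using p_step[where t = t and y = "c ! length t"] by (simp add: p_total)
  qed
  have step: "(\<Sum>r\<in>UNIV. p (t @ [r]) * \<phi> t r) \<le> exp (1 / real n) * p t" for t
  proof -
    have "(\<Sum>r\<in>UNIV. p (t @ [r]) * \<phi> t r) \<le> (\<Sum>r\<in>UNIV. p (t @ [r]) * (1 + l * z (length t) r + 1 / real n))"
      by (intro sum_mono mult_left_mono \<phi> p_nonneg)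
    also have "\<dots> = (1 + 1 / real n) * (\<Sum>r\<in>UNIV. p (t @ [r])) + l * (\<Sum>r\<in>UNIV. p (t @ [r]) * z (length t) r)"
      unfolding sum_distrib_left sum.distrib[symmetric]
      by (intro sum.cong refl) (simp add: algebra_simps)
    also have "\<dots> \<le> (1 + 1 / real n) * p t"
      using drift[of t] l0 by (simp add: p_total mult_nonneg_nonpos)
    also have "\<dots> \<le> exp (1 / real n) * p t"
      by (intro mult_right_mono exp_ge_add_one_self p_nonneg)
    finally show ?thesis .
  qed
  have G0: "0 \<le> G" using coeffs fstar by (simp add: G_def)
  have pt: "(if accepts fstar t then \<Sum>i<n. if outbit (t ! i) = c ! i then 1 else 0 else 0)
      \<le> pathprod \<phi> t / l + real n * G" if len: "length t = n" for t
  proof (cases "accepts fstar t")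
    case True
    define Z where "Z = (\<Sum>i<n. z i (t ! i))"
    have "pathprod \<phi> t = exp (l * Z)"
      unfolding pathprod_def \<phi>_def Z_def sum_distrib_left using len by (simp add: exp_sum)
    moreover have "l * Z \<le> exp (l * Z)" using exp_ge_add_one_self[of "l * Z"] by linarith
    ultimately have ZZ: "Z \<le> pathprod \<phi> t / l" using l0 by (simp add: pos_le_divide_eq mult.commute)
    have "Z = (\<Sum>i<n. if outbit (t ! i) = c ! i then 1 else 0) - \<alpha> * (\<Sum>i<n. if flag (t ! i) then 0 else 1)
        - real n * (1/2 + \<beta>)"
      unfolding Z_def z_def sum_subtractf sum_distrib_left by simp
    moreover have "\<alpha> * (\<Sum>i<n. if flag (t ! i) then 0 else 1) \<le> \<alpha> * (real n * (1 - fstar))"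
      using True coeffs len unfolding accepts_iff by (intro mult_left_mono) auto
    ultimately show ?thesis using ZZ True by (simp add: G_def algebra_simps)
  next
    case False
    have "0 \<le> pathprod \<phi> t" by (auto simp: pathprod_def \<phi>_def intro: prod_nonneg)
    then show ?thesis using False G0 l0 by simp
  qed
  have "(\<Sum>t | length t = n. p t * (if accepts fstar t then \<Sum>i<n. if outbit (t ! i) = c ! i then 1 else 0 else 0))
     \<le> (\<Sum>t | length t = n. p t * (pathprod \<phi> t / l + real n * G))"
    by (intro sum_mono mult_left_mono pt p_nonneg) auto
  also have "\<dots> = (\<Sum>t | length t = n. p t * pathprod \<phi> t) / l + real n * G * (\<Sum>t | length t = n. p t)"
    unfolding sum_divide_distrib sum_distrib_left sum.distrib[symmetric]
    by (intro sum.cong refl) (simp add: algebra_simps)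
  also have "\<dots> \<le> exp (1 / real n) ^ n / l + real n * G"
    using sum_pathprod_le[of n p \<phi> "exp (1 / real n)", OF step] l0
    by (simp add: p_total_length p_Nil \<phi>_def divide_right_mono)
  also have "exp (1 / real n) ^ n / l = exp 1 * K * sqrt (real n)"
    using n by (simp add: exp_of_nat_mult[symmetric] l_def)
  finally show ?thesis by simp
qed

text \<open>Conditional probability of failing the next test. On a prefix of weight 0 it is 0 by the
  convention for division, and \<open>fail_prob_mult\<close> holds there as well.\<close>

definition fail_prob :: "round list \<Rightarrow> real" where
  "fail_prob t = (\<Sum>r | \<not> flag r. p (t @ [r])) / p t"

lemma fail_sum_le: "(\<Sum>r | \<not> flag r. p (t @ [r])) \<le> p t"
  using sum_mono2[of UNIV "{r. \<not> flag r}" "\<lambda>r. p (t @ [r])"] by (simp add: p_total p_nonneg)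

lemma fail_prob_mult: "fail_prob t * p t = (\<Sum>r | \<not> flag r. p (t @ [r]))"
proof (cases "p t = 0")
  case True
  have "0 \<le> (\<Sum>r | \<not> flag r. p (t @ [r]))" by (intro sum_nonneg p_nonneg)
  then show ?thesis using True fail_sum_le[of t] by simp
qed (simp add: fail_prob_def)

lemma fail_prob_bounds: "0 \<le> fail_prob t" "fail_prob t \<le> 1"
proof -
  show "0 \<le> fail_prob t" unfolding fail_prob_def by (intro divide_nonneg_nonneg sum_nonneg p_nonneg)
  show "fail_prob t \<le> 1" using fail_sum_le[of t] p_nonneg[of t]
    by (cases "p t = 0") (simp_all add: fail_prob_def divide_le_eq)
qed

text \<open>The compensator of the failure count, built from conditional probabilities instead of
  observed flags, minus the number of failures that the test tolerates.\<close>

definition excess :: "real \<Rightarrow> round list \<Rightarrow> real" where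
  "excess fstar t = (\<Sum>i<length t. fail_prob (take i t) - (1 - fstar))"

text \<open>A round that extends the string has conditional weight at most G (1 + x) \<le> G exp x,
  where x is \<alpha>/G times the deviation of the failure probability from 1 - fstar. Discounting
  by exp (-x) leaves the factor \<open>G\<close>; the accumulated discount depends on the transcript
  only through \<open>excess\<close>.\<close>

lemma low_excess_string_le:
  assumes fstar: "fstar \<le> 1" and c: "length c = n"
  defines "G \<equiv> 1/2 + \<beta> + \<alpha> * (1 - fstar)"
  shows "(\<Sum>t | length t = n. p t * (if xor_out t = c \<and> excess fstar t \<le> \<Delta> then 1 else 0))
     \<le> exp (\<alpha> / G * \<Delta>) * G ^ n"
proof -
  have G: "1/2 \<le> G" using coeffs fstar by (simp add: G_def)
  define g where "g = \<alpha> / G"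
  have g: "0 \<le> g" using coeffs G by (simp add: g_def)
  define \<phi> where "\<phi> t r = (if outbit r = c ! length t then exp (- g * (fail_prob t - (1 - fstar))) else 0)" for t r
  have step: "(\<Sum>r\<in>UNIV. p (t @ [r]) * \<phi> t r) \<le> G * p t" for t
  proof -
    define x where "x = g * (fail_prob t - (1 - fstar))"
    have "(\<Sum>r\<in>UNIV. p (t @ [r]) * \<phi> t r) = exp (- x) * (\<Sum>r | outbit r = c ! length t. p (t @ [r]))"
      unfolding sum_Collect_if sum_distrib_left by (intro sum.cong refl) (simp add: \<phi>_def x_def)
    also have "\<dots> \<le> exp (- x) * ((1/2 + \<beta>) * p t + \<alpha> * (fail_prob t * p t))"
      unfolding fail_prob_mult by (intro mult_left_mono p_step) simp
    also have "(1/2 + \<beta>) * p t + \<alpha> * (fail_prob t * p t) = G * (1 + x) * p t"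
    proof -
      have "G * x = \<alpha> * (fail_prob t - (1 - fstar))" using G by (simp add: x_def g_def)
      then have "G * (1 + x) = 1/2 + \<beta> + \<alpha> * fail_prob t"
        unfolding distrib_left by (simp add: G_def algebra_simps)
      then show ?thesis by (simp add: algebra_simps)
    qed
    also have "exp (- x) * (G * (1 + x) * p t) = G * p t * (exp (- x) * (1 + x))" by simp
    also have "\<dots> \<le> G * p t * (exp (- x) * exp x)"
      using G p_nonneg[of t] by (intro mult_left_mono exp_ge_add_one_self) auto
    finally show ?thesis by (simp add: exp_minus)
  qed
  have pt: "(if xor_out t = c \<and> excess fstar t \<le> \<Delta> then 1 else 0) \<le> exp (g * \<Delta>) * pathprod \<phi> t"
    if len: "length t = n" for t
  proof (cases "xor_out t = c \<and> excess fstar t \<le> \<Delta>")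
    case True
    have "pathprod \<phi> t = (\<Prod>i<n. exp (- g * (fail_prob (take i t) - (1 - fstar))))"
      unfolding pathprod_def \<phi>_def len using True xor_out_eq_iff[OF len c] len
      by (intro prod.cong refl) simp
    also have "\<dots> = exp (- g * excess fstar t)"
      unfolding excess_def sum_distrib_left len by (simp add: exp_sum)
    finally have "exp (g * \<Delta>) * pathprod \<phi> t = exp (g * (\<Delta> - excess fstar t))"
      by (simp add: exp_add[symmetric] algebra_simps)
    moreover have "0 \<le> g * (\<Delta> - excess fstar t)" using True g by simp
    ultimately show ?thesis using True by simp
  next
    case False
    then show ?thesis by (auto simp: pathprod_def \<phi>_def intro!: mult_nonneg_nonneg prod_nonneg)
  qed
  have "(\<Sum>t | length t = n. p t * (if xor_out t = c \<and> excess fstar t \<le> \<Delta> then 1 else 0))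
     \<le> (\<Sum>t | length t = n. p t * (exp (g * \<Delta>) * pathprod \<phi> t))"
    by (intro sum_mono mult_left_mono pt p_nonneg) auto
  also have "\<dots> = exp (g * \<Delta>) * (\<Sum>t | length t = n. p t * pathprod \<phi> t)"
    by (simp add: sum_distrib_left mult_ac)
  also have "\<dots> \<le> exp (g * \<Delta>) * G ^ n"
    using sum_pathprod_le[of n p \<phi> G, OF step] G
    by (intro mult_left_mono) (simp_all add: \<phi>_def p_Nil)
  finally show ?thesis by (simp add: g_def)
qed

text \<open>Acceptance caps the observed failures, so a large \<open>excess\<close> forces the sum
  of the martingale differences (failure probability minus observed failure) to be large. The
  estimate is of Azuma-Hoeffding type.\<close>

lemma accepted_high_excess_le:
  assumes l: "0 \<le> l"
  shows "(\<Sum>t | length t = n. p t * (if accepts fstar t \<and> \<Delta> < excess fstar t then 1 else 0))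
     \<le> exp (real n * (l\<^sup>2 / 2) - l * \<Delta>)"
proof -
  define \<phi> where "\<phi> t r = exp (l * (fail_prob t - (if flag r then 0 else 1)))" for t r
  have step: "(\<Sum>r\<in>UNIV. p (t @ [r]) * \<phi> t r) \<le> exp (l\<^sup>2 / 2) * p t" for t
  proof -
    let ?x = "fail_prob t"
    have "(\<Sum>r\<in>UNIV. p (t @ [r]) * \<phi> t r) = exp (l * ?x) * (\<Sum>r\<in>UNIV. p (t @ [r]))
        + exp (l * ?x) * (exp (- l) - 1) * (\<Sum>r | \<not> flag r. p (t @ [r]))"
      unfolding sum_Collect_if sum_distrib_left sum.distrib[symmetric]
      by (intro sum.cong refl) (simp add: \<phi>_def exp_add[symmetric] algebra_simps)
    also have "\<dots> = exp (l * ?x) * (1 - ?x + ?x * exp (- l)) * p t"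
      unfolding p_total fail_prob_mult[symmetric] by (simp add: algebra_simps)
    also have "\<dots> \<le> exp (l * ?x) * exp (- l * ?x + l\<^sup>2 / 2) * p t"
      using fail_prob_bounds[of t] l
      by (intro mult_right_mono mult_left_mono bernoulli_mgf_le p_nonneg) auto
    finally show ?thesis by (simp add: exp_add[symmetric])
  qed
  have pt: "(if accepts fstar t \<and> \<Delta> < excess fstar t then 1 else 0) \<le> exp (- l * \<Delta>) * pathprod \<phi> t"
    if len: "length t = n" for t
  proof (cases "accepts fstar t \<and> \<Delta> < excess fstar t")
    case True
    define B where "B = (\<Sum>i<n. fail_prob (take i t) - (if flag (t ! i) then 0 else 1))"
    have "pathprod \<phi> t = exp (l * B)"
      unfolding pathprod_def \<phi>_def B_def sum_distrib_left using len by (simp add: exp_sum)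
    then have "exp (- l * \<Delta>) * pathprod \<phi> t = exp (l * (B - \<Delta>))"
      by (simp add: exp_add[symmetric] algebra_simps)
    moreover have "excess fstar t \<le> B"
      using True len unfolding accepts_iff excess_def B_def sum_subtractf
      by (simp add: algebra_simps)
    then have "0 \<le> l * (B - \<Delta>)" using True l by simp
    ultimately show ?thesis using True by simp
  next
    case False
    then show ?thesis by (auto simp: pathprod_def \<phi>_def intro!: mult_nonneg_nonneg prod_nonneg)
  qed
  have "(\<Sum>t | length t = n. p t * (if accepts fstar t \<and> \<Delta> < excess fstar t then 1 else 0))
     \<le> (\<Sum>t | length t = n. p t * (exp (- l * \<Delta>) * pathprod \<phi> t))"
    by (intro sum_mono mult_left_mono pt p_nonneg) auto
  also have "\<dots> = exp (- l * \<Delta>) * (\<Sum>t | length t = n. p t * pathprod \<phi> t)"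
    by (simp add: sum_distrib_left mult_ac)
  also have "\<dots> \<le> exp (- l * \<Delta>) * exp (l\<^sup>2 / 2) ^ n"
    using sum_pathprod_le[of n p \<phi> "exp (l\<^sup>2 / 2)", OF step]
    by (intro mult_left_mono) (simp_all add: \<phi>_def p_Nil)
  also have "\<dots> = exp (real n * (l\<^sup>2 / 2) - l * \<Delta>)"
    by (simp add: exp_of_nat_mult[symmetric] exp_add[symmetric])
  finally show ?thesis .
qed

end

section \<open>Entropy of the output against a dishonest Alice\<close>

lemma ent_term_nonneg: "0 \<le> p \<Longrightarrow> p \<le> 1 \<Longrightarrow> 0 \<le> ent_term p"
  by (auto simp: ent_term_def mult_nonneg_nonpos)

text \<open>By ln (1 + v/u) \<le> v/u, the extra mass costs the term of \<open>u\<close> at most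
  \<open>v\<close> nats, and v ln (u + v) is nonpositive; 1 / ln 2 converts nats to bits.\<close>

lemma ent_term_add_ge:
  assumes "0 \<le> u" "0 \<le> v" "u + v \<le> 1"
  shows "ent_term u - v / ln 2 \<le> ent_term (u + v)"
proof (cases "u = 0")
  case True
  have "0 \<le> v / ln 2" using assms by simp
  moreover have "ent_term u = 0" "0 \<le> ent_term (u + v)"
    using True ent_term_nonneg[of v] assms by (simp_all add: ent_term_def)
  ultimately show ?thesis by linarith
next
  case False
  then have u: "0 < u" using assms by simp
  have "u + v = u * (1 + v / u)" using u by (simp add: distrib_left)
  then have "ln (u + v) = ln (u * (1 + v / u))" by (rule arg_cong)
  also have "\<dots> = ln u + ln (1 + v / u)"
    using u assms by (intro ln_mult_pos) (simp_all add: add_pos_nonneg)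
  also have "ln (1 + v / u) \<le> v / u" using u assms by (intro ln_add_one_self_le_self) simp
  finally have "u * ln (u + v) \<le> u * (ln u + v / u)" using u by (intro mult_left_mono) auto
  moreover have "v * ln (u + v) \<le> 0" using assms u by (intro mult_nonneg_nonpos) auto
  ultimately have "- u * ln u - v \<le> - (u + v) * ln (u + v)" using u by (simp add: algebra_simps)
  then have "(- u * ln u - v) / ln 2 \<le> - (u + v) * ln (u + v) / ln 2" by (intro divide_right_mono) auto
  then show ?thesis using u assms by (simp add: ent_term_def log_def diff_divide_distrib)
qed

lemma ent_term_ge:
  assumes "0 \<le> u" "u \<le> k"
  shows "u * (- log 2 k) \<le> ent_term u"
proof (cases "u = 0")
  case False
  then have "log 2 u \<le> log 2 k" using assms by simp
  then show ?thesis using assms False by (simp add: ent_term_def mult_left_mono)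
qed (simp add: ent_term_def)

text \<open>A min-entropy argument for \<open>U\<close>: each unit of its mass contributes at least
  \<open>- log 2 k\<close>. Adding the exceptional part \<open>V\<close> lowers the entropy by at
  most its mass in nats.\<close>

lemma shannon_ge_of_bounded_part:
  assumes X: "finite X" and Y: "\<And>x. x \<in> X \<Longrightarrow> Y x = U x + V x"
    and U: "\<And>x. x \<in> X \<Longrightarrow> 0 \<le> U x" "\<And>x. x \<in> X \<Longrightarrow> U x \<le> k"
    and V: "\<And>x. x \<in> X \<Longrightarrow> 0 \<le> V x" and sum1: "(\<Sum>x\<in>X. Y x) = 1"
  shows "(1 - (\<Sum>x\<in>X. V x)) * (- log 2 k) - (\<Sum>x\<in>X. V x) / ln 2 \<le> shannon Y X"
proof -
  have "(\<Sum>x\<in>X. U x) = 1 - (\<Sum>x\<in>X. V x)" using sum1 Y by (simp add: sum.distrib)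
  then have "(1 - (\<Sum>x\<in>X. V x)) * (- log 2 k) - (\<Sum>x\<in>X. V x) / ln 2
     = (\<Sum>x\<in>X. U x * (- log 2 k) - V x / ln 2)"
    by (simp add: sum_subtractf sum_negf sum_distrib_right[symmetric] sum_divide_distrib[symmetric])
  also have "\<dots> \<le> (\<Sum>x\<in>X. ent_term (Y x))"
  proof (rule sum_mono)
    fix x assume x: "x \<in> X"
    have "Y x \<le> (\<Sum>x\<in>X. Y x)" using X U V Y x by (intro member_le_sum) auto
    then show "U x * (- log 2 k) - V x / ln 2 \<le> ent_term (Y x)"
      using ent_term_add_ge[of "U x" "V x"] ent_term_ge[of "U x" k] U V Y x sum1 by fastforce
  qed
  finally show ?thesis by (simp add: shannon_def)
qed

lemma finite_bitstrings: "finite (bitstrings n)"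
  unfolding bitstrings_def by (rule finite_lists_length_UNIV)

lemma card_bitstrings: "card (bitstrings n) = 2 ^ n"
  using card_lists_length_eq[of "UNIV :: bool set" n] by (simp add: bitstrings_def)

lemma sum_bitstrings_delta:
  "length x = n \<Longrightarrow> (\<Sum>c\<in>bitstrings n. if x = c then F c else (0::real)) = F x"
  using finite_bitstrings[of n] by (simp add: bitstrings_def)

context string_process
begin

lemma output_shannon_ge:
  assumes fstar: "fstar \<le> 1" and n: "3 \<le> n"
  defines "G \<equiv> 1/2 + \<beta> + \<alpha> * (1 - fstar)"
  shows "- real n * log 2 G - (2 + 1 / ln 2 + 2 * \<alpha> / (G * ln 2)) * sqrt (real n * ln (real n))
     \<le> shannon (\<lambda>c. \<Sum>t | length t = n. p t * (if accepts fstar t then if xor_out t = c then 1 else 0 else 1 / 2 ^ n))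
         (bitstrings n)" (is "_ \<le> shannon ?Y _")
proof -
  have G: "1/2 \<le> G" using coeffs fstar by (simp add: G_def)
  have "exp 1 \<le> real n" using exp_le n by linarith
  then have lnn: "1 \<le> ln (real n)" using n by (subst ln_ge_iff) auto
  have n0: "0 < real n" using n by simp
  define Q where "Q = sqrt (real n * ln (real n))"
  \<comment> \<open>With this choice and the next, n l^2/2 - l \<Delta> = (1/2 - 2) ln n, so the
    exceptional part has weight at most 1/n. That is small enough, since \<open>- log 2 k\<close> is
    at most n.\<close>
  define \<Delta> where "\<Delta> = 2 * Q"
  define l where "l = sqrt (ln (real n) / real n)"
  have Q1: "1 \<le> Q"
  proof -
    have "1 * 1 \<le> real n * ln (real n)" using lnn n by (intro mult_mono) auto
    then show ?thesis by (simp add: Q_def)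
  qed
  have lQ: "l * Q = ln (real n)"
  proof -
    have "l * Q = sqrt ((ln (real n))\<^sup>2)"
      using n0 unfolding l_def Q_def real_sqrt_mult[symmetric] by (simp add: power2_eq_square)
    then show ?thesis using lnn by simp
  qed
  have l2: "l\<^sup>2 = ln (real n) / real n" using lnn n0 by (simp add: l_def)
  have l0: "0 \<le> l" using lnn n0 by (simp add: l_def)
  \<comment> \<open>Aborts belong to the bounded part: their strings have probability 2^-n, which
    does not exceed the bound for accepted transcripts because G \<ge> 1/2. Hence the factor 2 in
    \<open>k\<close>.\<close>
  define U where "U c = (\<Sum>t | length t = n. p t * (if accepts fstar t
      then if xor_out t = c \<and> excess fstar t \<le> \<Delta> then 1 else 0 else 1 / 2 ^ n))" for c
  define V where "V c = (\<Sum>t | length t = n. p t * (if accepts fstar t \<and> xor_out t = c \<and> \<Delta> < excess fstar t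
      then 1 else 0))" for c
  define k where "k = 2 * (exp (\<alpha> / G * \<Delta>) * G ^ n)"
  have YUV: "?Y c = U c + V c" for c
    unfolding U_def V_def sum.distrib[symmetric] distrib_left[symmetric]
    by (intro sum.cong refl) auto
  have U0: "0 \<le> U c" for c unfolding U_def by (intro sum_nonneg mult_nonneg_nonneg p_nonneg) auto
  have V0: "0 \<le> V c" for c unfolding V_def by (intro sum_nonneg mult_nonneg_nonneg p_nonneg) auto
  have \<Delta>0: "0 \<le> \<Delta>" using Q1 by (simp add: \<Delta>_def)
  have kn: "1 / 2 ^ n \<le> exp (\<alpha> / G * \<Delta>) * G ^ n"
  proof -
    have "1 * (1/2) ^ n \<le> exp (\<alpha> / G * \<Delta>) * G ^ n"
      using G \<Delta>0 coeffs by (intro mult_mono power_mono) auto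
    then show ?thesis by (simp add: power_one_over)
  qed
  have Uk: "U c \<le> k" if "c \<in> bitstrings n" for c
  proof -
    have "U c \<le> (\<Sum>t | length t = n. p t * (if xor_out t = c \<and> excess fstar t \<le> \<Delta> then 1 else 0) + p t * (1 / 2 ^ n))"
      unfolding U_def distrib_left[symmetric]
      by (intro sum_mono mult_left_mono p_nonneg) auto
    also have "\<dots> = (\<Sum>t | length t = n. p t * (if xor_out t = c \<and> excess fstar t \<le> \<Delta> then 1 else 0)) + 1 / 2 ^ n"
      unfolding sum.distrib sum_distrib_right[symmetric] p_total_length by simp
    also have "\<dots> \<le> k"
      using low_excess_string_le[OF fstar, of c n \<Delta>] kn that unfolding k_def G_def[symmetric]
      by (simp add: bitstrings_def)
    finally show ?thesis .
  qed
  have Y1: "(\<Sum>c\<in>bitstrings n. ?Y c) = 1"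
  proof -
    have "(\<Sum>c\<in>bitstrings n. ?Y c) = (\<Sum>t | length t = n. p t * (\<Sum>c\<in>bitstrings n.
        if accepts fstar t then if xor_out t = c then 1 else 0 else 1 / 2 ^ n))"
      unfolding sum_distrib_left by (rule sum.swap)
    also have "\<dots> = (\<Sum>t | length t = n. p t * 1)"
    proof (intro sum.cong refl arg_cong2[where f = "(*)"])
      fix t :: "round list" assume "t \<in> {t. length t = n}"
      then have "length (xor_out t) = n" by (simp add: xor_out_def)
      then show "(\<Sum>c\<in>bitstrings n. if accepts fstar t then if xor_out t = c then 1 else 0 else 1 / 2 ^ n) = (1::real)"
        using sum_bitstrings_delta[of "xor_out t" n "\<lambda>_. 1"]
        by (cases "accepts fstar t") (simp_all add: card_bitstrings)
    qed
    finally show ?thesis using p_total_length by simp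
  qed
  define v where "v = (\<Sum>c\<in>bitstrings n. V c)"
  have v0: "0 \<le> v" unfolding v_def by (intro sum_nonneg V0)
  have v1: "v \<le> 1 / real n"
  proof -
    have "v = (\<Sum>t | length t = n. p t * (\<Sum>c\<in>bitstrings n.
        if accepts fstar t \<and> xor_out t = c \<and> \<Delta> < excess fstar t then 1 else 0))"
      unfolding v_def V_def sum_distrib_left by (rule sum.swap)
    also have "\<dots> = (\<Sum>t | length t = n. p t * (if accepts fstar t \<and> \<Delta> < excess fstar t then 1 else 0))"
    proof (intro sum.cong refl arg_cong2[where f = "(*)"])
      fix t :: "round list" assume "t \<in> {t. length t = n}"
      then have len: "length (xor_out t) = n" by (simp add: xor_out_def)
      have "(\<Sum>c\<in>bitstrings n. if accepts fstar t \<and> xor_out t = c \<and> \<Delta> < excess fstar t then 1 else 0)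
        = (\<Sum>c\<in>bitstrings n. if xor_out t = c then if accepts fstar t \<and> \<Delta> < excess fstar t then 1 else 0 else (0::real))"
        by (intro sum.cong) auto
      then show "(\<Sum>c\<in>bitstrings n. if accepts fstar t \<and> xor_out t = c \<and> \<Delta> < excess fstar t then 1 else 0)
        = (if accepts fstar t \<and> \<Delta> < excess fstar t then 1 else (0::real))"
        using sum_bitstrings_delta[OF len] by simp
    qed
    also have "\<dots> \<le> exp (real n * (l\<^sup>2 / 2) - l * \<Delta>)" by (rule accepted_high_excess_le[OF l0])
    also have "real n * (l\<^sup>2 / 2) - l * \<Delta> \<le> - ln (real n)"
      using n0 lnn lQ unfolding l2 \<Delta>_def by simp
    finally show ?thesis using n0 by (simp add: exp_minus inverse_eq_divide)
  qed
  define X where "X = - log 2 k"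
  have Xeq: "X = - 1 - \<alpha> / G * \<Delta> / ln 2 - real n * log 2 G"
  proof -
    have "ln k = ln 2 + \<alpha> / G * \<Delta> + real n * ln G"
      unfolding k_def using G by (simp add: ln_mult_pos ln_realpow)
    then show ?thesis by (simp add: X_def log_def add_divide_distrib)
  qed
  have "X \<le> real n"
  proof -
    have "1 / 2 ^ n \<le> k" using kn G unfolding k_def by (simp add: order_trans)
    moreover have "k > 0" using G by (simp add: k_def)
    ultimately have "log 2 (1 / 2 ^ n) \<le> log 2 k" by simp
    then show ?thesis by (simp add: X_def log_divide log_nat_power)
  qed
  then have "v * X \<le> v * real n" using v0 by (rule mult_left_mono)
  also have "\<dots> \<le> 1" using v1 n0 by (simp add: field_simps)
  finally have vX: "v * X \<le> 1" .
  have "1 / real n \<le> 1" using n by simp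
  then have "v \<le> 1" using v1 by linarith
  then have vl: "v / ln 2 \<le> 1 / ln 2" by (intro divide_right_mono) auto
  have "(1 - v) * X - v / ln 2 \<le> shannon ?Y (bitstrings n)"
    unfolding v_def X_def
    by (rule shannon_ge_of_bounded_part[OF finite_bitstrings YUV U0 Uk V0 Y1])
  moreover have "X - 1 - 1 / ln 2 \<le> (1 - v) * X - v / ln 2"
    using vX vl by (simp add: algebra_simps)
  moreover have "- real n * log 2 G - (2 + 1 / ln 2 + 2 * \<alpha> / (G * ln 2)) * Q \<le> X - 1 - 1 / ln 2"
  proof -
    \<comment> \<open>The additive losses 1 + 1 + 1 / ln 2 are absorbed into the coefficient of
      \<open>Q\<close>, which is at least 1.\<close>
    have A: "(2 + 1 / ln 2) * 1 \<le> (2 + 1 / ln 2) * Q" using Q1 by (intro mult_left_mono) auto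
    have eq: "2 * \<alpha> / (G * ln 2) * Q = - 1 - real n * log 2 G - X" unfolding Xeq by (simp add: \<Delta>_def)
    show ?thesis unfolding distrib_right[of "2 + 1 / ln 2"] eq using A by simp
  qed
  ultimately show ?thesis unfolding Q_def by linarith
qed

end

section \<open>Honest parties over the noisy channel\<close>

lemma pass_prob_bounds:
  assumes "unitvec d (\<psi> a)" "cptp d d EK"
  shows "0 \<le> pass_prob d \<psi> EK a" "pass_prob d \<psi> EK a \<le> 1"
proof -
  let ?A = "kapply d EK (proj (\<psi> a))"
  have psd: "psd d ?A" by (intro psd_kapply psd_proj)
  then show "0 \<le> pass_prob d \<psi> EK a" by (simp add: pass_prob_def psd_def)
  have u: "vinner d (\<psi> a) (\<psi> a) = 1" using assms by (simp add: vinner_unit)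
  have "Re (quadform d ?A (\<psi> a)) \<le> Re (mtrace d ?A)"
    by (rule quadform_le_mtrace[OF psd u])
  moreover have "mtrace d ?A = vinner d (\<psi> a) (\<psi> a)"
    unfolding mtrace_kapply_cptp[OF assms(2)] by (simp add: mtrace_def proj_def vinner_def mult.commute)
  ultimately show "pass_prob d \<psi> EK a \<le> 1" using u by (simp add: pass_prob_def)
qed

text \<open>Fixing the output bit fixes \<open>b\<close> for each \<open>a\<close>, so every round
  contributes exactly 1/2 and without the test each string has probability 2^-n. The test can only
  remove weight; a Chernoff bound for this loss is carried out jointly with the event that the
  output is \<open>c\<close>, which keeps the factor 2^-n.\<close>

lemma honest_correctness:
  assumes \<psi>: "unitvec d (\<psi> False)" "unitvec d (\<psi> True)" and EK: "cptp d d EK"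
    and fid: "fstar < chan_fid d \<psi> EK" and c: "length c = n"
  shows "(1 - exp (- real n * (chan_fid d \<psi> EK - fstar)\<^sup>2 / 2)) / 2 ^ n \<le> honest_xy d \<psi> EK fstar n c"
    and "honest_xy d \<psi> EK fstar n c \<le> (1 + exp (- real n * (chan_fid d \<psi> EK - fstar)\<^sup>2 / 2)) / 2 ^ n"
proof -
  define F where "F = chan_fid d \<psi> EK"
  \<comment> \<open>Minimiser of -l (F - fstar) + l^2/2, the exponent per round in the Chernoff
    bound.\<close>
  define l where "l = F - fstar"
  define p where "p = prob_honest d \<psi> EK"
  have pp: "0 \<le> pass_prob d \<psi> EK a" "pass_prob d \<psi> EK a \<le> 1" for a
    using pass_prob_bounds[OF _ EK] \<psi> by (cases a; simp)+
  have F: "0 \<le> F" "F \<le> 1" "pass_prob d \<psi> EK False + pass_prob d \<psi> EK True = 2 * F"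
    using pp[of True] pp[of False] by (auto simp: F_def chan_fid_def)
  have l: "0 < l" using fid by (simp add: l_def F_def)
  have p0: "0 \<le> p t" for t
    unfolding p_def prob_honest_def by (intro prod_list_nonneg) (auto simp: pp)
  have snoc: "p (t @ [(a, b, f)]) = p t * (1/4) * (if f then pass_prob d \<psi> EK a else 1 - pass_prob d \<psi> EK a)" for t a b f
    by (simp add: p_def prob_honest_def)
  have pNil: "p [] = 1" by (simp add: p_def prob_honest_def)
  \<comment> \<open>\<open>g\<close> is the factor for a passed test: the value 1 gives the law of
    the output, exp (-l) the exponential moment.\<close>
  define \<phi> where "\<phi> g t r = (if outbit r = c ! length t then if flag r then g else 1 else 0)"
    for g :: real and t :: "round list" and r
  have step: "(\<Sum>r\<in>UNIV. p (t @ [r]) * \<phi> g t r) = (1/2 * (1 - F + F * g)) * p t" for t g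
  proof -
    have "(\<Sum>r\<in>UNIV. p (t @ [r]) * \<phi> g t r) =
        p t * (1/4) * ((pass_prob d \<psi> EK False + pass_prob d \<psi> EK True) * g
          + (2 - (pass_prob d \<psi> EK False + pass_prob d \<psi> EK True)))"
      unfolding sum_round by (cases "c ! length t") (simp_all add: UNIV_bool snoc \<phi>_def outbit_def flag_def field_simps)
    then show ?thesis unfolding F(3) by (simp add: algebra_simps)
  qed
  have path: "pathprod (\<phi> (exp (- l))) t = (if xor_out t = c then exp (- l * real (length (filter (\<lambda>(a, b, f). f) t))) else 0)"
    if len: "length t = n" for t
  proof (cases "xor_out t = c")
    case True
    have "pathprod (\<phi> (exp (- l))) t = (\<Prod>i<n. exp (- l * (if flag (t ! i) then 1 else 0)))"
      unfolding pathprod_def \<phi>_def len using True xor_out_eq_iff[OF len c] len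
      by (intro prod.cong refl) auto
    also have "\<dots> = exp (- l * real (length (filter (\<lambda>(a, b, f). f) t)))"
      unfolding length_filter_flag sum_distrib_left len by (simp add: exp_sum)
    finally show ?thesis using True by simp
  next
    case False
    then obtain i where "i < n" "outbit (t ! i) \<noteq> c ! i" using xor_out_eq_iff[OF len c] by blast
    then have "pathprod (\<phi> (exp (- l))) t = 0"
      unfolding pathprod_def len using len by (intro prod_zero) (auto simp: \<phi>_def)
    then show ?thesis using False by simp
  qed
  have path1: "pathprod (\<phi> 1) t = (if xor_out t = c then 1 else 0)" if len: "length t = n" for t
  proof (cases "xor_out t = c")
    case True
    then show ?thesis using xor_out_eq_iff[OF len c] len
      unfolding pathprod_def \<phi>_def by (auto intro!: prod.neutral)
  next
    case False
    then obtain i where "i < n" "outbit (t ! i) \<noteq> c ! i" using xor_out_eq_iff[OF len c] by blast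
    then have "pathprod (\<phi> 1) t = 0"
      unfolding pathprod_def len using len by (intro prod_zero) (auto simp: \<phi>_def)
    then show ?thesis using False by simp
  qed
  have tot: "(\<Sum>t | length t = n. p t * (if xor_out t = c then 1 else 0)) = 1 / 2 ^ n"
  proof -
    have "(\<Sum>t | length t = n. p t * (if xor_out t = c then 1 else 0)) = (\<Sum>t | length t = n. p t * pathprod (\<phi> 1) t)"
      by (intro sum.cong refl) (simp add: path1)
    also have "\<dots> = (1/2 * (1 - F + F * 1)) ^ n * p []"
      by (rule sum_pathprod_eq) (rule step)
    finally show ?thesis by (simp add: pNil power_one_over)
  qed
  have hxy: "honest_xy d \<psi> EK fstar n c = (\<Sum>t | length t = n. p t * (if accepts fstar t \<and> xor_out t = c then 1 else 0))"
    by (simp add: honest_xy_def transcripts_def p_def)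
  have upper: "honest_xy d \<psi> EK fstar n c \<le> 1 / 2 ^ n"
    unfolding hxy tot[symmetric] by (intro sum_mono mult_left_mono p0) auto
  define R where "R = (\<Sum>t | length t = n. p t * (if \<not> accepts fstar t \<and> xor_out t = c then 1 else 0))"
  have split: "honest_xy d \<psi> EK fstar n c = 1 / 2 ^ n - R"
    unfolding hxy R_def tot[symmetric] sum_subtractf[symmetric] right_diff_distrib[symmetric]
    by (intro sum.cong refl) auto
  have "R \<le> (\<Sum>t | length t = n. p t * (exp (l * (real n * fstar)) * pathprod (\<phi> (exp (- l))) t))"
    unfolding R_def
  proof (intro sum_mono mult_left_mono p0)
    fix t :: "round list" assume "t \<in> {t. length t = n}"
    then have len: "length t = n" by simp
    let ?k = "real (length (filter (\<lambda>(a, b, f). f) t))"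
    have "1 \<le> exp (l * (real n * fstar)) * exp (- l * ?k)" if "\<not> accepts fstar t"
    proof -
      have "0 \<le> l * (real n * fstar - ?k)" using that l len by (simp add: accepts_def)
      then show ?thesis by (simp add: exp_add[symmetric] algebra_simps)
    qed
    then show "(if \<not> accepts fstar t \<and> xor_out t = c then 1 else 0)
       \<le> exp (l * (real n * fstar)) * pathprod (\<phi> (exp (- l))) t"
      unfolding path[OF len] by auto
  qed
  also have "\<dots> = exp (l * (real n * fstar)) * (\<Sum>t | length t = n. p t * pathprod (\<phi> (exp (- l))) t)"
    by (simp add: sum_distrib_left mult_ac)
  also have "(\<Sum>t | length t = n. p t * pathprod (\<phi> (exp (- l))) t) = (1/2 * (1 - F + F * exp (- l))) ^ n"
    using sum_pathprod_eq[of n p "\<phi> (exp (- l))", OF step] by (simp add: pNil)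
  also have "\<dots> \<le> (1/2 * exp (- l * F + l\<^sup>2 / 2)) ^ n"
    using F l by (intro power_mono mult_left_mono bernoulli_mgf_le) auto
  also have "exp (l * (real n * fstar)) * (1/2 * exp (- l * F + l\<^sup>2 / 2)) ^ n
      = exp (l * (real n * fstar) + real n * (- l * F + l\<^sup>2 / 2)) / 2 ^ n"
    by (simp add: power_mult_distrib exp_of_nat_mult exp_add power_one_over power_divide)
  also have "l * (real n * fstar) + real n * (- l * F + l\<^sup>2 / 2) = - real n * l\<^sup>2 / 2"
    by (simp add: l_def power2_eq_square field_simps)
  finally have "R \<le> exp (- real n * l\<^sup>2 / 2) / 2 ^ n" by simp
  then show "(1 - exp (- real n * (chan_fid d \<psi> EK - fstar)\<^sup>2 / 2)) / 2 ^ n \<le> honest_xy d \<psi> EK fstar n c"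
    unfolding split by (simp add: l_def F_def diff_divide_distrib)
  show "honest_xy d \<psi> EK fstar n c \<le> (1 + exp (- real n * (chan_fid d \<psi> EK - fstar)\<^sup>2 / 2)) / 2 ^ n"
    by (rule order_trans[OF upper]) (intro divide_right_mono, auto)
qed

subsection \<open>Dishonest Bob\<close>

text \<open>Contracting the second factor of the test vector with \<open>v\<close> turns the form
  into that of \<rho>.\<close>

lemma psd_kron_proj:
  assumes "psd m \<rho>"
  shows "psd (m * d) (kron d d \<rho> (proj v))"
proof -
  have "quadform (m * d) (kron d d \<rho> (proj v)) w = quadform m \<rho> (\<lambda>i. \<Sum>k<d. cnj (v k) * w (i * d + k))" for w
  proof -
    have "quadform (m * d) (kron d d \<rho> (proj v)) w
       = (\<Sum>i<m. \<Sum>k<d. \<Sum>j<m. \<Sum>l<d. cnj (w (i*d+k)) * (\<rho> i j * (v k * cnj (v l))) * w (j*d+l))"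
      unfolding quadform_def sum_prod_index by (intro sum.cong refl) (simp add: kron_def proj_def)
    also have "\<dots> = (\<Sum>i<m. \<Sum>j<m. \<Sum>k<d. \<Sum>l<d. cnj (w (i*d+k)) * (\<rho> i j * (v k * cnj (v l))) * w (j*d+l))"
      by (rule sum.cong[OF refl], rule sum.swap)
    also have "\<dots> = (\<Sum>i<m. \<Sum>j<m. \<rho> i j * ((\<Sum>k<d. cnj (cnj (v k) * w (i*d+k))) * (\<Sum>l<d. cnj (v l) * w (j*d+l))))"
      unfolding sum_product unfolding sum_distrib_left by (intro sum.cong refl) (simp add: mult_ac)
    also have "\<dots> = quadform m \<rho> (\<lambda>i. \<Sum>k<d. cnj (v k) * w (i * d + k))"
      unfolding quadform_def cnj_sum by (intro sum.cong refl) (simp add: mult_ac)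
    finally show ?thesis .
  qed
  then show ?thesis using assms by (simp add: psd_def)
qed

lemma mtrace_kron_proj: "mtrace (m * d) (kron d d \<rho> (proj v)) = mtrace m \<rho> * vinner d v v"
proof -
  have "mtrace (m * d) (kron d d \<rho> (proj v)) = (\<Sum>i<m. \<Sum>k<d. \<rho> i i * (cnj (v k) * v k))"
    unfolding mtrace_def sum_prod_index by (intro sum.cong refl) (simp add: kron_def proj_def)
  then show ?thesis by (simp add: mtrace_def vinner_def sum_product)
qed

lemma psd_stB:
  assumes "valid_bstrat d S"
  shows "psd (bmem S) (stB d \<psi> S h)"
proof (induction h)
  case Nil
  then show ?case using assms by (simp add: valid_bstrat_def density_def psd_def)
next
  case (Cons r h)
  obtain a b where r: "r = (a, b)" by (cases r)
  have "psd (bmem S) (kapply (bmem S * d) (binst S h b) (kron d d (stB d \<psi> S h) (proj (\<psi> a))))"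
    by (intro psd_kapply psd_kron_proj Cons)
  then show ?case unfolding r by (simp add: psd_def quadform_divide)
qed

text \<open>Weight of the reply with Kraus operators \<open>Ks\<close> when \<open>v\<close> arrives
  while the memory is in state \<rho>. No normalisation of \<open>v\<close> is built in, so it can
  be evaluated at unnormalised eigenvectors.\<close>

definition reply_weight :: "nat \<Rightarrow> nat \<Rightarrow> cmat list \<Rightarrow> cmat \<Rightarrow> cvec \<Rightarrow> real" where
  "reply_weight m d Ks \<rho> v = Re (mtrace m (kapply (m * d) Ks (kron d d \<rho> (proj v))))"

lemma reply_weight_nonneg:
  assumes "psd m \<rho>"
  shows "0 \<le> reply_weight m d Ks \<rho> v"
  unfolding reply_weight_def by (intro psd_mtrace_nonneg psd_kapply psd_kron_proj assms)

lemma reply_weight_total: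
  assumes "instrument2 (m * d) m Kf"
  shows "reply_weight m d (Kf False) \<rho> v + reply_weight m d (Kf True) \<rho> v = Re (mtrace m \<rho> * vinner d v v)"
proof -
  let ?R = "kron d d \<rho> (proj v)"
  have "mtrace m (kapply (m * d) (Kf False) ?R) + mtrace m (kapply (m * d) (Kf True) ?R)
     = (\<Sum>l<m*d. \<Sum>l'<m*d. (\<Sum>a\<in>UNIV. kraus_sum m (Kf a) l' l) * ?R l l')"
    unfolding mtrace_kapply by (simp add: UNIV_bool sum.distrib distrib_right add.commute)
  also have "\<dots> = mtrace m \<rho> * vinner d v v"
    unfolding instrument2_sum[OF assms] sum_idm_quadratic mtrace_kron_proj ..
  finally show ?thesis unfolding reply_weight_def by (metis plus_complex.sel(1))
qed

lemma reply_weight_combination: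
  assumes "\<And>k l. proj u k l = proj v k l + of_real z * (proj e k l - proj e' k l)"
  shows "reply_weight m d Ks \<rho> u
     = reply_weight m d Ks \<rho> v + z * (reply_weight m d Ks \<rho> e - reply_weight m d Ks \<rho> e')"
proof -
  have "mtrace m (kapply (m * d) Ks (kron d d \<rho> (proj u))) = mtrace m (kapply (m * d) Ks (kron d d \<rho> (proj v)))
     + of_real z * (mtrace m (kapply (m * d) Ks (kron d d \<rho> (proj e))) - mtrace m (kapply (m * d) Ks (kron d d \<rho> (proj e'))))"
    unfolding mtrace_kapply right_diff_distrib sum_distrib_left sum_subtractf[symmetric] sum.distrib[symmetric]
    by (intro sum.cong refl) (simp add: kron_def assms algebra_simps)
  then show ?thesis by (simp add: reply_weight_def)
qed

text \<open>In the basis \<open>u, w\<close> with \<open>v = g (c u + s w)\<close>, the operator \<open>|u><u| - |v><v|\<close> is \<open>s\<close> times the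
  reflection with rows \<open>(s, -c)\<close> and \<open>(-c, -s)\<close>. The vectors \<open>e\<close> and \<open>e'\<close> are its unnormalised
  eigenvectors for \<open>1\<close> and \<open>-1\<close>.\<close>

lemma helstrom_bound:
  assumes \<rho>: "psd m \<rho>" and inst: "instrument2 (m * d) m Kf"
    and u: "vinner d u u = 1" and v: "vinner d v v = 1"
    and c: "cmod (vinner d u v) = c" and s: "0 < s" "c\<^sup>2 + s\<^sup>2 = 1"
  shows "reply_weight m d (Kf b) \<rho> u + reply_weight m d (Kf (\<not> b)) \<rho> v \<le> (1 + s) * Re (mtrace m \<rho>)"
proof -
  obtain w g where w: "vinner d w w = 1" "vinner d u w = 0" "cmod g = 1"
    and vw: "v = (\<lambda>i. g * (of_real c * u i + of_real s * w i))"
    using unit_pair_decomposition[OF u v c s] by metis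
  define e where "e i = of_real (1 + s) * u i - of_real c * w i" for i
  define e' where "e' i = of_real c * u i + of_real (1 + s) * w i" for i
  define N where "N = 2 * (1 + s)"
  have N: "0 < N" using s by (simp add: N_def)
  have gg: "g * cnj g = 1" using w(3) complex_norm_square[of g] by simp
  have c2: "c\<^sup>2 = 1 - s\<^sup>2" using s by simp
  have c2': "complex_of_real c * of_real c = 1 - of_real s * of_real s"
    using arg_cong[OF c2, of complex_of_real] by (simp add: power2_eq_square)
  have e: "vinner d e e = of_real N"
  proof -
    have "cnj (e i) * e i = of_real ((1 + s)\<^sup>2) * (cnj (u i) * u i) + of_real (c\<^sup>2) * (cnj (w i) * w i)
       - of_real ((1 + s) * c) * (cnj (u i) * w i) - of_real ((1 + s) * c) * (cnj (w i) * u i)" for i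
      by (simp add: e_def power2_eq_square algebra_simps)
    then have "vinner d e e = of_real ((1 + s)\<^sup>2) * vinner d u u + of_real (c\<^sup>2) * vinner d w w
       - of_real ((1 + s) * c) * vinner d u w - of_real ((1 + s) * c) * vinner d w u"
      by (simp only: vinner_def sum.distrib sum_subtractf sum_distrib_left[symmetric])
    also have "vinner d w u = 0" using w(2) vinner_commute[of d w u] by simp
    also have "of_real ((1 + s)\<^sup>2) * vinner d u u + of_real (c\<^sup>2) * vinner d w w
       - of_real ((1 + s) * c) * vinner d u w - of_real ((1 + s) * c) * 0 = complex_of_real ((1 + s)\<^sup>2 + c\<^sup>2)"
      unfolding u w by simp
    also have "(1 + s)\<^sup>2 + c\<^sup>2 = N" unfolding c2 N_def by (simp add: power2_eq_square algebra_simps)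
    finally show ?thesis .
  qed
  have diff: "proj u k l = proj v k l + of_real (s / N) * (proj e k l - proj e' k l)" for k l
  proof -
    have pv: "proj v k l = (of_real c * u k + of_real s * w k) * cnj (of_real c * u l + of_real s * w l)"
    proof -
      have "proj v k l = (g * cnj g) * ((of_real c * u k + of_real s * w k) * cnj (of_real c * u l + of_real s * w l))"
        by (simp add: vw proj_def mult_ac)
      then show ?thesis using gg by simp
    qed
    have "of_real s * (proj e k l - proj e' k l) = of_real N * (proj u k l - proj v k l)"
    proof -
      have "proj e k l - proj e' k l = ((1 + of_real s) * (1 + of_real s) - of_real c * of_real c) * (u k * cnj (u l) - w k * cnj (w l))
          - 2 * (1 + of_real s) * of_real c * (u k * cnj (w l) + w k * cnj (u l))"
        by (simp add: e_def e'_def proj_def algebra_simps)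
      also have "(1 + of_real s) * (1 + of_real s) - complex_of_real c * of_real c = 2 * of_real s * (1 + of_real s)"
        unfolding c2' by (simp add: algebra_simps)
      finally have 1: "proj e k l - proj e' k l = 2 * (1 + of_real s) * (of_real s * (u k * cnj (u l) - w k * cnj (w l))
          - of_real c * (u k * cnj (w l) + w k * cnj (u l)))"
        by (simp add: algebra_simps)
      have "proj u k l - proj v k l = (1 - of_real c * of_real c) * (u k * cnj (u l))
          - of_real s * of_real s * (w k * cnj (w l)) - of_real s * of_real c * (u k * cnj (w l) + w k * cnj (u l))"
        unfolding pv by (simp add: proj_def algebra_simps)
      also have "\<dots> = of_real s * (of_real s * (u k * cnj (u l) - w k * cnj (w l))
          - of_real c * (u k * cnj (w l) + w k * cnj (u l)))"
        unfolding c2' by (simp add: algebra_simps)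
      finally have 2: "proj u k l - proj v k l = of_real s * (of_real s * (u k * cnj (u l) - w k * cnj (w l))
          - of_real c * (u k * cnj (w l) + w k * cnj (u l)))" .
      show ?thesis unfolding 1 2 N_def by simp
    qed
    then show ?thesis using N by (simp add: field_simps)
  qed
  let ?W = "\<lambda>b. reply_weight m d (Kf b) \<rho>"
  have tot: "?W b x + ?W (\<not> b) x = Re (mtrace m \<rho> * vinner d x x)" for x
    using reply_weight_total[OF inst, of \<rho> x] by (cases b) simp_all
  \<comment> \<open>The weight at \<open>e\<close> is at most its total N tr \<rho> and the weight
    at \<open>e'\<close> is nonnegative. With s / N in front, the gain over the total tr \<rho> at
    \<open>v\<close> is at most s tr \<rho>.\<close>
  have "?W b u = ?W b v + s / N * (?W b e - ?W b e')"
    by (rule reply_weight_combination[OF diff])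
  moreover have "?W b e - ?W b e' \<le> N * Re (mtrace m \<rho>)"
    using tot[of e] reply_weight_nonneg[OF \<rho>, of d "Kf (\<not> b)" e] reply_weight_nonneg[OF \<rho>, of d "Kf b" e']
    unfolding e by (simp add: mult.commute)
  then have "s / N * (?W b e - ?W b e') \<le> s / N * (N * Re (mtrace m \<rho>))"
    using s N by (intro mult_left_mono) auto
  moreover have "?W b v + ?W (\<not> b) v = Re (mtrace m \<rho>)" using tot[of v] v by simp
  ultimately show ?thesis using N by (simp add: algebra_simps)
qed

section \<open>The law of Alice's output and the chain rule\<close>

definition outbitB :: "bool \<times> bool \<Rightarrow> bool" where "outbitB r = (case r of (a, b) \<Rightarrow> a \<noteq> b)"

lemma sum_roundB: "(\<Sum>r\<in>(UNIV::(bool \<times> bool) set). F r) = (\<Sum>a\<in>UNIV. \<Sum>b\<in>UNIV. F (a, b))"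
  by (simp add: UNIV_Times_UNIV[symmetric] sum.cartesian_product' del: UNIV_Times_UNIV)

locale bit_process =
  fixes p :: "(bool \<times> bool) list \<Rightarrow> real" and \<kappa> :: real
  assumes p_Nil: "p [] = 1"
    and p_nonneg: "0 \<le> p t"
    and p_total: "(\<Sum>r\<in>UNIV. p (t @ [r])) = p t"
    and p_step: "(\<Sum>r | outbitB r = y. p (t @ [r])) \<le> \<kappa> * p t"
    and \<kappa>: "1/2 \<le> \<kappa>" "\<kappa> \<le> 1"

lemma bit_process_probB:
  assumes u: "unitvec d (\<psi> False)" and v: "unitvec d (\<psi> True)"
    and c: "cmod (vinner d (\<psi> False) (\<psi> True)) = c" and s: "0 < s" "c\<^sup>2 + s\<^sup>2 = 1"
    and S: "valid_bstrat d S"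
  shows "bit_process (probB d \<psi> S) ((1 + s) / 2)"
proof
  have unit: "vinner d (\<psi> a) (\<psi> a) = 1" for a using vinner_unit u v by (cases a) auto
  have inst: "instrument2 (bmem S * d) (bmem S) (binst S h)" for h using S by (simp add: valid_bstrat_def)
  let ?W = "\<lambda>t b. reply_weight (bmem S) d (binst S (rev t) b) (stB d \<psi> S (rev t))"
  have snoc: "probB d \<psi> S (t @ [(a, b)]) = ?W t b (\<psi> a) / 2" for t a b
    by (simp add: probB_def reply_weight_def mtrace_def sum_divide_distrib[symmetric])
  show "probB d \<psi> S [] = 1" using S by (simp add: probB_def valid_bstrat_def density_def)
  show "0 \<le> probB d \<psi> S t" for t unfolding probB_def by (intro psd_mtrace_nonneg psd_stB S)
  have tot: "?W t False (\<psi> a) + ?W t True (\<psi> a) = probB d \<psi> S t" for t a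
    using reply_weight_total[OF inst] unit by (simp add: probB_def)
  show "(\<Sum>r\<in>UNIV. probB d \<psi> S (t @ [r])) = probB d \<psi> S t" for t
    unfolding sum_roundB using tot[of t False] tot[of t True] by (simp add: UNIV_bool snoc field_simps)
  have "s\<^sup>2 \<le> 1\<^sup>2" using s(2) zero_le_power2[of c] unfolding one_power2 by linarith
  then show "1/2 \<le> (1 + s) / 2" "(1 + s) / 2 \<le> 1" using s power2_le_imp_le[of s 1] by simp_all
  show "(\<Sum>r | outbitB r = y. probB d \<psi> S (t @ [r])) \<le> (1 + s) / 2 * probB d \<psi> S t" for y t
  proof -
    have "(\<Sum>r | outbitB r = y. probB d \<psi> S (t @ [r])) = (?W t y (\<psi> False) + ?W t (\<not> y) (\<psi> True)) / 2"
      unfolding sum_Collect_if sum_roundB by (cases y) (simp_all add: UNIV_bool outbitB_def snoc field_simps)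
    moreover have "?W t y (\<psi> False) + ?W t (\<not> y) (\<psi> True) \<le> (1 + s) * probB d \<psi> S t"
      unfolding probB_def by (rule helstrom_bound[OF psd_stB[OF S] inst unit unit c s])
    ultimately show ?thesis by simp
  qed
qed

lemma ent_term_mult: "ent_term (q * x) = q * ent_term x + x * ent_term q" if "0 \<le> q" "0 \<le> x"
  using that by (auto simp: ent_term_def log_mult_pos algebra_simps)

lemma bin_ent_antimono:
  assumes "1/2 \<le> x" "x \<le> y" "y \<le> 1"
  shows "bin_ent y \<le> bin_ent x"
proof (cases "y = 1")
  case True
  then have "bin_ent y = 0" by (simp add: bin_ent_def ent_term_def)
  then show ?thesis using assms by (auto simp: bin_ent_def intro!: add_nonneg_nonneg ent_term_nonneg)
next
  case False
  \<comment> \<open>The endpoint 1 is split off because \<open>H\<close> is not differentiable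
    there.\<close>
  define H where "H z = - z * ln z - (1 - z) * ln (1 - z)" for z :: real
  have bin: "bin_ent z = H z / ln 2" if "0 < z" "z < 1" for z
    using that by (simp add: bin_ent_def ent_term_def H_def log_def) (simp add: field_simps)
  have "H y \<le> H x"
  proof (rule DERIV_nonpos_imp_nonincreasing[OF assms(2)])
    fix z assume z: "x \<le> z" "z \<le> y"
    then have z': "0 < z" "z < 1" "1/2 \<le> z" using assms False by auto
    have "(H has_real_derivative (ln (1 - z) - ln z)) (at z)"
      unfolding H_def[abs_def] using z' by (auto intro!: derivative_eq_intros)
    moreover have "ln (1 - z) - ln z \<le> 0" using z' by simp
    ultimately show "\<exists>D. (H has_real_derivative D) (at z) \<and> D \<le> 0" by blast
  qed
  then show ?thesis using assms False by (simp add: bin divide_right_mono)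
qed

text \<open>Splitting the mass a + b adds a + b times the binary entropy of the share x = a / (a +
  b). Neither share exceeds \<kappa>, so the larger one lies between 1/2 and \<kappa>, where binary
  entropy decreases.\<close>

lemma ent_term_split_ge:
  assumes a: "0 \<le> a" "a \<le> \<kappa> * (a + b)" and b: "0 \<le> b" "b \<le> \<kappa> * (a + b)" and \<kappa>: "\<kappa> \<le> 1"
  shows "ent_term (a + b) + (a + b) * bin_ent \<kappa> \<le> ent_term a + ent_term b"
proof (cases "a + b = 0")
  case True
  then have "a = 0" "b = 0" using a b by auto
  then show ?thesis by (simp add: ent_term_def)
next
  case False
  define q where "q = a + b"
  define x where "x = a / q"
  have q: "0 < q" using False a b by (simp add: q_def)
  have ax: "a = q * x" "b = q * (1 - x)" using q by (simp_all add: x_def q_def field_simps)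
  have x: "0 \<le> x" "x \<le> 1" using a b q by (simp_all add: x_def q_def)
  have x\<kappa>: "x \<le> \<kappa>" "1 - x \<le> \<kappa>"
  proof -
    have "a / q \<le> \<kappa>" "b / q \<le> \<kappa>" using a(2) b(2) q by (simp_all add: q_def[symmetric] pos_divide_le_eq)
    moreover have "1 - x = b / q" unfolding ax(2) using q by simp
    ultimately show "x \<le> \<kappa>" "1 - x \<le> \<kappa>" by (simp_all add: x_def)
  qed
  have "bin_ent \<kappa> \<le> bin_ent x"
  proof (cases "1/2 \<le> x")
    case True
    then show ?thesis using x\<kappa> \<kappa> by (intro bin_ent_antimono)
  next
    case False
    then have "bin_ent \<kappa> \<le> bin_ent (1 - x)" using x\<kappa> \<kappa> by (intro bin_ent_antimono) auto
    then show ?thesis by (simp add: bin_ent_def)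
  qed
  then have "q * bin_ent \<kappa> \<le> q * bin_ent x" using q by simp
  moreover have "ent_term a + ent_term b = q * bin_ent x + ent_term q"
    using q x ent_term_mult[of q x] ent_term_mult[of q "1 - x"]
    unfolding ax(1)[symmetric] ax(2)[symmetric] by (simp add: bin_ent_def algebra_simps)
  ultimately show ?thesis by (simp add: q_def)
qed

context bit_process
begin

lemma p_total_length: "(\<Sum>t | length t = n. p t) = 1"
  using sum_pathprod_eq[of n p "\<lambda>_ _. 1" 1] by (simp add: p_total p_Nil pathprod_def)

text \<open>No acceptance event restricts the sum, so linearity of expectation suffices and no
  deviation term appears.\<close>

lemma matches_le: "(\<Sum>t | length t = n. p t * (\<Sum>i<n. if outbitB (t ! i) = c ! i then 1 else 0)) \<le> real n * \<kappa>"
proof (induction n)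
  case 0
  then show ?case by simp
next
  case (Suc n)
  have "(\<Sum>t | length t = Suc n. p t * (\<Sum>i<Suc n. if outbitB (t ! i) = c ! i then 1 else 0))
     = (\<Sum>t | length t = n. (\<Sum>i<n. if outbitB (t ! i) = c ! i then 1 else 0) * (\<Sum>r\<in>UNIV. p (t @ [r]))
         + (\<Sum>r\<in>UNIV. p (t @ [r]) * (if outbitB r = c ! n then 1 else 0)))"
    unfolding sum_lists_length_Suc sum_distrib_left[of _ _ UNIV] sum.distrib[symmetric]
  proof (intro sum.cong refl)
    fix t :: "(bool \<times> bool) list" and r assume "t \<in> {t. length t = n}"
    then have len: "length t = n" by simp
    have "(\<Sum>i<n. if outbitB ((t @ [r]) ! i) = c ! i then 1 else 0) = (\<Sum>i<n. if outbitB (t ! i) = c ! i then 1 else (0::real))"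
      using len by (intro sum.cong refl) (simp add: nth_append)
    then show "p (t @ [r]) * (\<Sum>i<Suc n. if outbitB ((t @ [r]) ! i) = c ! i then 1 else 0)
       = (\<Sum>i<n. if outbitB (t ! i) = c ! i then 1 else 0) * p (t @ [r]) + p (t @ [r]) * (if outbitB r = c ! n then 1 else 0)"
      using len nth_append_length[of t r "[]"] by (simp add: algebra_simps)
  qed
  also have "\<dots> \<le> (\<Sum>t | length t = n. p t * (\<Sum>i<n. if outbitB (t ! i) = c ! i then 1 else 0) + \<kappa> * p t)"
    unfolding p_total sum_Collect_if[symmetric] by (intro sum_mono add_mono p_step) simp
  also have "\<dots> \<le> real n * \<kappa> + \<kappa>"
    unfolding sum.distrib sum_distrib_left[symmetric] p_total_length using Suc.IH by simp
  finally show ?case by (simp add: algebra_simps)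
qed

text \<open>The number of rounds is read off \<open>c\<close>, so the laws of all lengths form one
  function and appending a bit refines it.\<close>

definition xdist :: "bool list \<Rightarrow> real" where
  "xdist c = (\<Sum>t | length t = length c. p t * (if xor_outB t = c then 1 else 0))"

lemma xdist_snoc: "xdist (c @ [y]) = (\<Sum>t | length t = length c. (if xor_outB t = c then 1 else 0) * (\<Sum>r | outbitB r = y. p (t @ [r])))"
  unfolding xdist_def sum_Collect_if sum_distrib_left length_append list.size
    add_0 One_nat_def add_Suc_right add_0_right sum_lists_length_Suc
  by (intro sum.cong refl) (auto simp: xor_outB_def outbitB_def)

lemma xdist_snoc_sum: "xdist (c @ [False]) + xdist (c @ [True]) = xdist c"
proof -
  have "(\<Sum>r | outbitB r = False. p (t @ [r])) + (\<Sum>r | outbitB r = True. p (t @ [r])) = p t" for t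
  proof -
    have "(\<Sum>r | outbitB r = False. p (t @ [r])) + (\<Sum>r | outbitB r = True. p (t @ [r])) = (\<Sum>r\<in>UNIV. p (t @ [r]))"
      unfolding sum_Collect_if sum.distrib[symmetric] by (intro sum.cong refl) auto
    then show ?thesis by (simp add: p_total)
  qed
  then show ?thesis
    unfolding xdist_snoc sum.distrib[symmetric] distrib_left[symmetric]
    by (simp add: xdist_def mult.commute)
qed

lemma xdist_snoc_le: "xdist (c @ [y]) \<le> \<kappa> * xdist c"
proof -
  have "xdist (c @ [y]) \<le> (\<Sum>t | length t = length c. \<kappa> * (p t * (if xor_outB t = c then 1 else 0)))"
    unfolding xdist_snoc using p_step[where y = y] by (intro sum_mono) simp
  then show ?thesis by (simp add: xdist_def sum_distrib_left)
qed

lemma xdist_nonneg: "0 \<le> xdist c"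
  unfolding xdist_def by (intro sum_nonneg mult_nonneg_nonneg p_nonneg) auto

lemma xdist_total: "(\<Sum>c\<in>bitstrings n. xdist c) = 1"
proof (induction n)
  case 0
  then show ?case by (simp add: bitstrings_def xdist_def p_Nil xor_outB_def)
next
  case (Suc n)
  then show ?case
    by (simp add: bitstrings_def sum_lists_length_Suc UNIV_bool xdist_snoc_sum add.commute)
qed

text \<open>Chain rule: given any prefix, the next bit adds at least \<open>bin_ent\<close> of
  \<kappa>, and the prefix weights sum to 1.\<close>

lemma shannon_xdist_ge: "real n * bin_ent \<kappa> \<le> shannon xdist (bitstrings n)"
proof (induction n)
  case 0
  have "ent_term (xdist []) = 0" by (simp add: xdist_def p_Nil xor_outB_def ent_term_def)
  then show ?case by (simp add: shannon_def bitstrings_def)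
next
  case (Suc n)
  have "real (Suc n) * bin_ent \<kappa> = real n * bin_ent \<kappa> + (\<Sum>c\<in>bitstrings n. xdist c) * bin_ent \<kappa>"
    by (simp add: xdist_total algebra_simps)
  also have "\<dots> \<le> (\<Sum>c\<in>bitstrings n. ent_term (xdist c) + xdist c * bin_ent \<kappa>)"
    using Suc.IH by (simp add: shannon_def sum.distrib sum_distrib_right)
  also have "\<dots> \<le> (\<Sum>c\<in>bitstrings n. ent_term (xdist (c @ [False])) + ent_term (xdist (c @ [True])))"
  proof (rule sum_mono)
    fix c
    show "ent_term (xdist c) + xdist c * bin_ent \<kappa> \<le> ent_term (xdist (c @ [False])) + ent_term (xdist (c @ [True]))"
      using ent_term_split_ge[of "xdist (c @ [False])" \<kappa> "xdist (c @ [True])"]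
      by (simp add: xdist_snoc_sum xdist_nonneg xdist_snoc_le \<kappa>)
  qed
  also have "\<dots> = shannon xdist (bitstrings (Suc n))"
    by (simp add: shannon_def bitstrings_def sum_lists_length_Suc UNIV_bool add.commute)
  finally show ?case .
qed

end

subsection \<open>The bounds for the protocol\<close>

lemma alice_bounds:
  assumes u: "unitvec d (\<psi> False)" and v: "unitvec d (\<psi> True)"
    and c: "cmod (vinner d (\<psi> False) (\<psi> True)) = c" and s: "0 < s" "c\<^sup>2 + s\<^sup>2 = 1" and fstar: "fstar < 1"
  defines "G \<equiv> 1/2 + sqrt (1 - fstar) / (sqrt 2 * s\<^sup>2) + (1 - fstar) / s\<^sup>2"
  shows "\<exists>C. \<forall>n\<ge>3. \<forall>S. valid_astrat d S \<longrightarrow>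
      (\<forall>x. length x = n \<longrightarrow> avgA d \<psi> fstar n S x \<le> G + C * sqrt (ln (real n) / real n)) \<and>
      - real n * log 2 G - C * sqrt (real n * ln (real n)) \<le> shannon (ydistA d \<psi> fstar n S) (bitstrings n)"
proof -
  \<comment> \<open>This weight minimises t/(2 s^2) + (1 - fstar)/(4 t s^2). The two terms are then
    equal, and their sum t/s^2 is the square-root term of \<open>G\<close>.\<close>
  define t where "t = sqrt ((1 - fstar) / 2)"
  have t: "0 < t" using fstar by (simp add: t_def)
  have t2: "1 - fstar = 2 * t\<^sup>2" using fstar by (simp add: t_def)
  define \<alpha> where "\<alpha> = 1 / (4 * t * s\<^sup>2) + 1 / s\<^sup>2"
  define \<beta> where "\<beta> = t / (2 * s\<^sup>2)"
  have G: "1/2 + \<beta> + \<alpha> * (1 - fstar) = G"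
  proof -
    have "sqrt (1 - fstar) / (sqrt 2 * s\<^sup>2) = t / s\<^sup>2" by (simp add: t_def real_sqrt_divide)
    moreover have "\<alpha> * (1 - fstar) = t / (2 * s\<^sup>2) + (1 - fstar) / s\<^sup>2"
    proof -
      have "\<alpha> * (1 - fstar) = 1 / (4 * t * s\<^sup>2) * (2 * t\<^sup>2) + (1 - fstar) / s\<^sup>2"
        unfolding \<alpha>_def distrib_right t2[symmetric] by simp
      also have "1 / (4 * t * s\<^sup>2) * (2 * t\<^sup>2) = t / (2 * s\<^sup>2)" using t by (simp add: power2_eq_square)
      finally show ?thesis .
    qed
    ultimately show ?thesis by (simp add: G_def \<beta>_def)
  qed
  have pos: "0 < \<alpha>" "0 \<le> \<beta>" using t s by (simp_all add: \<alpha>_def \<beta>_def add_pos_pos)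
  have G0: "0 < G" using pos fstar unfolding G[symmetric] by (simp add: add_pos_nonneg)
  define C1 where "C1 = exp 1 * (2 + \<alpha> + \<beta>)"
  define C2 where "C2 = 2 + 1 / ln 2 + 2 * \<alpha> / (G * ln 2)"
  have C: "0 \<le> C1" "0 \<le> C2" using pos G0 by (simp_all add: C1_def C2_def)
  have main: "avgA d \<psi> fstar n S x \<le> G + C1 * sqrt (ln (real n) / real n)"
    "- real n * log 2 G - C2 * sqrt (real n * ln (real n)) \<le> shannon (ydistA d \<psi> fstar n S) (bitstrings n)"
    if n: "3 \<le> n" and S: "valid_astrat d S" for n S x
  proof -
    interpret string_process "probA d \<psi> S" \<alpha> \<beta>
      unfolding \<alpha>_def \<beta>_def by (rule string_process_probA[OF u v c s t S])
    show "- real n * log 2 G - C2 * sqrt (real n * ln (real n)) \<le> shannon (ydistA d \<psi> fstar n S) (bitstrings n)"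
      using output_shannon_ge[of fstar n] fstar n
      unfolding G C2_def ydistA_def[abs_def] transcripts_def by simp
    have "(\<Sum>i<n. \<Sum>t | length t = n. probA d \<psi> S t * (if accepts fstar t \<and> xor_out t ! i = x ! i then 1 else 0))
       = (\<Sum>t | length t = n. \<Sum>i<n. probA d \<psi> S t * (if accepts fstar t \<and> xor_out t ! i = x ! i then 1 else 0))"
      by (rule sum.swap)
    also have "\<dots> = (\<Sum>t | length t = n. probA d \<psi> S t * (if accepts fstar t then \<Sum>i<n. if outbit (t ! i) = x ! i then 1 else 0 else 0))"
      by (intro sum.cong refl) (auto simp: nth_xor_out sum_distrib_left intro!: sum.cong)
    also have "\<dots> \<le> real n * G + C1 * sqrt (real n)"
      using accepted_matches_le[of n fstar x] fstar n unfolding G C1_def by simp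
    finally have "avgA d \<psi> fstar n S x \<le> 1 / real n * (real n * G + C1 * sqrt (real n))"
      unfolding avgA_def transcripts_def by (intro mult_left_mono) auto
    also have "\<dots> = G + C1 * (sqrt (real n) / real n)" using n by (simp add: field_simps)
    also have "sqrt (real n) / real n = sqrt (1 / real n)"
      by (simp add: real_sqrt_divide real_div_sqrt sqrt_divide_self_eq inverse_eq_divide)
    \<comment> \<open>The bias argument yields an error of order 1 / sqrt n; the logarithm is
      inserted to match the claimed form, which is allowed since ln n \<ge> 1 from n = 3 on.\<close>
    also have "G + C1 * sqrt (1 / real n) \<le> G + C1 * sqrt (ln (real n) / real n)"
    proof -
      have "exp 1 \<le> real n" using exp_le n by linarith
      then have "1 \<le> ln (real n)" using n by (subst ln_ge_iff) auto
      then show ?thesis using C n by (intro add_left_mono mult_left_mono) (auto intro: divide_right_mono)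
    qed
    finally show "avgA d \<psi> fstar n S x \<le> G + C1 * sqrt (ln (real n) / real n)" .
  qed
  show ?thesis
  proof (intro exI[of _ "C1 + C2"] allI impI conjI)
    fix n :: nat and S assume n: "3 \<le> n" and S: "valid_astrat d S"
    have "0 \<le> C1 * sqrt (real n * ln (real n))" using C n by simp
    then show "- real n * log 2 G - (C1 + C2) * sqrt (real n * ln (real n)) \<le> shannon (ydistA d \<psi> fstar n S) (bitstrings n)"
      using main(2)[OF n S] unfolding distrib_right by linarith
    fix x :: "bool list"
    have "0 \<le> C2 * sqrt (ln (real n) / real n)" using C n by simp
    then show "avgA d \<psi> fstar n S x \<le> G + (C1 + C2) * sqrt (ln (real n) / real n)"
      using main(1)[OF n S, of x] unfolding distrib_right by linarith
  qed
qed

lemma bob_bounds: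
  assumes u: "unitvec d (\<psi> False)" and v: "unitvec d (\<psi> True)"
    and c: "cmod (vinner d (\<psi> False) (\<psi> True)) = c" and s: "0 < s" "c\<^sup>2 + s\<^sup>2 = 1"
    and S: "valid_bstrat d S" and n: "1 \<le> n"
  shows "avgB d \<psi> n S x \<le> 1/2 + s / 2"
    and "real n * bin_ent ((1 + s) / 2) \<le> shannon (xdistB d \<psi> n S) (bitstrings n)"
proof -
  interpret bit_process "probB d \<psi> S" "(1 + s) / 2"
    by (rule bit_process_probB[OF u v c s S])
  have "xdistB d \<psi> n S y = xdist y" if "y \<in> bitstrings n" for y
    using that by (simp add: xdistB_def xdist_def transcriptsB_def bitstrings_def)
  then show "real n * bin_ent ((1 + s) / 2) \<le> shannon (xdistB d \<psi> n S) (bitstrings n)"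
    using shannon_xdist_ge[of n] by (simp add: shannon_def)
  have "(\<Sum>i<n. \<Sum>t | length t = n. probB d \<psi> S t * (if xor_outB t ! i = x ! i then 1 else 0))
     = (\<Sum>t | length t = n. \<Sum>i<n. probB d \<psi> S t * (if xor_outB t ! i = x ! i then 1 else 0))"
    by (rule sum.swap)
  also have "\<dots> = (\<Sum>t | length t = n. probB d \<psi> S t * (\<Sum>i<n. if outbitB (t ! i) = x ! i then 1 else 0))"
    unfolding sum_distrib_left by (intro sum.cong refl) (simp add: xor_outB_def outbitB_def)
  also have "\<dots> \<le> real n * ((1 + s) / 2)" by (rule matches_le)
  finally have "avgB d \<psi> n S x \<le> 1 / real n * (real n * ((1 + s) / 2))"
    unfolding avgB_def transcriptsB_def by (intro mult_left_mono) auto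
  then show "avgB d \<psi> n S x \<le> 1/2 + s / 2" using n by (simp add: add_divide_distrib)
qed

theorem theorem4:
  fixes d :: nat and \<psi> :: "bool \<Rightarrow> cvec" and \<theta> fstar :: real and EK :: "cmat list"
  assumes "unitvec d (\<psi> False)" and "unitvec d (\<psi> True)"
    and "(cmod (vinner d (\<psi> False) (\<psi> True)))\<^sup>2 = (cos \<theta>)\<^sup>2"
    and "0 < \<theta>" and "\<theta> \<le> pi / 2"
    and "cptp d d EK"
    and "0 < fstar" and "fstar < chan_fid d \<psi> EK"
  shows
    "(\<forall>n::nat. 1 \<le> n \<longrightarrow> (\<forall>c. length c = n \<longrightarrow>
        (1 - exp (- real n * (chan_fid d \<psi> EK - fstar)\<^sup>2 / 2)) / 2 ^ n \<le> honest_xy d \<psi> EK fstar n c \<and>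
        honest_xy d \<psi> EK fstar n c \<le> (1 + exp (- real n * (chan_fid d \<psi> EK - fstar)\<^sup>2 / 2)) / 2 ^ n))
   \<and> (\<exists>C N. \<forall>n::nat. N \<le> n \<longrightarrow> (\<forall>S. valid_astrat d S \<longrightarrow>
        (\<forall>c. length c = n \<longrightarrow>
           avgA d \<psi> fstar n S c \<le> 1/2 + (sqrt (1 - fstar) / (sqrt 2 * (sin \<theta>)\<^sup>2)
              + (1 - fstar) / (sin \<theta>)\<^sup>2) + C * sqrt (ln (real n) / real n)) \<and>
        shannon (ydistA d \<psi> fstar n S) (bitstrings n) \<ge>
           - real n * log 2 (1/2 + sqrt (1 - fstar) / (sqrt 2 * (sin \<theta>)\<^sup>2)
              + (1 - fstar) / (sin \<theta>)\<^sup>2) - C * sqrt (real n * ln (real n))))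
   \<and> (\<forall>n::nat. 1 \<le> n \<longrightarrow> (\<forall>S. valid_bstrat d S \<longrightarrow>
        (\<forall>c. length c = n \<longrightarrow> avgB d \<psi> n S c \<le> 1/2 + sin \<theta> / 2) \<and>
        shannon (xdistB d \<psi> n S) (bitstrings n) \<ge> real n * bin_ent ((1 + sin \<theta>) / 2)))"
proof (intro conjI)
  note u = assms(1) and v = assms(2) and EK = assms(6) and fid = assms(8)
  have s: "0 < sin \<theta>" using assms(4,5) by (intro sin_gt_zero) auto
  have "0 \<le> cos \<theta>" using assms(4,5) by (intro cos_ge_zero) auto
  then have c: "cmod (vinner d (\<psi> False) (\<psi> True)) = cos \<theta>"
    using assms(3) by (simp add: power2_eq_iff_nonneg)
  have cs: "(cos \<theta>)\<^sup>2 + (sin \<theta>)\<^sup>2 = 1" by simp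
  \<comment> \<open>Strictness of fstar < 1 matters: the weight \<open>t\<close> in
    \<open>alice_bounds\<close> vanishes at fstar = 1, and the slope divides by it.\<close>
  have "chan_fid d \<psi> EK \<le> 1"
    using pass_prob_bounds[of d \<psi> False, OF u EK] pass_prob_bounds[of d \<psi> True, OF v EK] by (simp add: chan_fid_def)
  then have fstar: "fstar < 1" using fid by simp
  show "\<forall>n::nat. 1 \<le> n \<longrightarrow> (\<forall>c. length c = n \<longrightarrow>
        (1 - exp (- real n * (chan_fid d \<psi> EK - fstar)\<^sup>2 / 2)) / 2 ^ n \<le> honest_xy d \<psi> EK fstar n c \<and>
        honest_xy d \<psi> EK fstar n c \<le> (1 + exp (- real n * (chan_fid d \<psi> EK - fstar)\<^sup>2 / 2)) / 2 ^ n)"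
    using honest_correctness[OF u v EK fid] by blast
  show "\<exists>C N. \<forall>n::nat. N \<le> n \<longrightarrow> (\<forall>S. valid_astrat d S \<longrightarrow>
        (\<forall>c. length c = n \<longrightarrow>
           avgA d \<psi> fstar n S c \<le> 1/2 + (sqrt (1 - fstar) / (sqrt 2 * (sin \<theta>)\<^sup>2)
              + (1 - fstar) / (sin \<theta>)\<^sup>2) + C * sqrt (ln (real n) / real n)) \<and>
        shannon (ydistA d \<psi> fstar n S) (bitstrings n) \<ge>
           - real n * log 2 (1/2 + sqrt (1 - fstar) / (sqrt 2 * (sin \<theta>)\<^sup>2)
              + (1 - fstar) / (sin \<theta>)\<^sup>2) - C * sqrt (real n * ln (real n)))"
    using alice_bounds[OF u v c s cs fstar] unfolding add.assoc[symmetric] by blast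
  show "\<forall>n::nat. 1 \<le> n \<longrightarrow> (\<forall>S. valid_bstrat d S \<longrightarrow>
        (\<forall>c. length c = n \<longrightarrow> avgB d \<psi> n S c \<le> 1/2 + sin \<theta> / 2) \<and>
        shannon (xdistB d \<psi> n S) (bitstrings n) \<ge> real n * bin_ent ((1 + sin \<theta>) / 2))"
    using bob_bounds[OF u v c s cs] by blast
qed

end
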